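(* Let $d\ge1$, $t\ge1$ be integers, $0\le s\le d$, and let $X_t\subseteq\mathbb S^d$ be $h_s$-measurable with $0<h_s(X_t)<\infty$, together with an integrable weight $w_t:X_t\to[0,\infty)$, such that the upper Marcinkiewicz–Zygmund inequality of order $t$ holds: \[ \frac1{h_s(X_t)}\int_{X_t}|f(x)|^2w_t(x)\,dh_s(x)\le A\|f\|_{L^2(\mathbb S^d)}^2\quad\text{for all }f\in\Pi_t . \] Suppose there exist a point $x_t\in X_t$ and parameters $\nu\in(0,1)$, $q>0$ such that, with $r>0$ defined by $r^2=(1-\nu)\frac{d+2}{t(t+d)}$, \[ \int_{X_t\cap B_r(x_t)}w_t(x)\,dh_s(x)\ge q\,r^s . \] Then \[ h_s(X_t)\ge c\,\frac{\dim\Pi_t}{t^s},\qquad c=\frac{q\,\nu^2}{A}\Big(\frac{1-\nu}{1+d/t}\,(d+2)\Big)^{s/2}. \]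
   Context: $\mathbb S^d\subset\mathbb R^{d+1}$ is the unit sphere with normalized surface measure (total mass $1$), and $L^2$ norms are with respect to it. $h_s$ denotes the $s$-dimensional Hausdorff measure (with respect to the geodesic or Euclidean metric on $\mathbb S^d$). $B_r(x)=\{y\in\mathbb S^d:x\cdot y\ge\cos r\}$. $\Pi_t$ is the space of restrictions to $\mathbb S^d$ of polynomials in $d+1$ variables of degree at most $t$, $\dim\Pi_t=\binom{d+t}{t}+\binom{d+t-1}{t-1}$. *)

theory Defs
  imports "HOL-Analysis.Analysis"
begin

text \<open>Contribution of one covering set to the s-dimensional Hausdorff sum
  (with the conventions diam(empty)^s = 0 and diam(U)^0 = 1 for nonempty U).\<close>
definition hcontrib :: "real \<Rightarrow> 'a::metric_space set \<Rightarrow> ennreal" where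
  "hcontrib s U = (if U = {} then 0 else if s = 0 then 1 else ennreal (diameter U powr s))"

text \<open>s-dimensional Hausdorff outer measure (unnormalized; the theorem is invariant
  under rescaling of h_s).\<close>
definition hausdorff_outer :: "real \<Rightarrow> 'a::metric_space set \<Rightarrow> ennreal" where
  "hausdorff_outer s E =
     (SUP \<delta>\<in>{0<..}. INF U\<in>{U :: nat \<Rightarrow> 'a set. E \<subseteq> (\<Union>i. U i) \<and>
          (\<forall>i. bounded (U i) \<and> diameter (U i) \<le> \<delta>)}. (\<Sum>i. hcontrib s (U i)))"

definition hausdorff_measure :: "real \<Rightarrow> 'a::metric_space measure" where
  "hausdorff_measure s = measure_of UNIV
      (lambda_system UNIV UNIV (hausdorff_outer s)) (hausdorff_outer s)"

text \<open>Unit sphere S^d in R^(d+1), with d+1 = CARD('n).\<close>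
abbreviation usphere :: "(real^'n) set" where
  "usphere \<equiv> sphere 0 1"

text \<open>Normalized surface measure on the sphere: h_d restricted to S^d, normalized to mass 1.\<close>
definition sphere_L2sq :: "(real^'n \<Rightarrow> real) \<Rightarrow> real" where
  "sphere_L2sq f = (\<integral>x\<in>usphere. (f x)\<^sup>2 \<partial>hausdorff_measure (real (CARD('n) - 1)))
        / measure (hausdorff_measure (real (CARD('n) - 1))) (usphere :: (real^'n) set)"

definition cap :: "real^'n \<Rightarrow> real \<Rightarrow> (real^'n) set" where
  "cap x r = {y \<in> usphere. x \<bullet> y \<ge> cos r}"

definition poly_space :: "nat \<Rightarrow> (real^'n \<Rightarrow> real) set" where
  "poly_space t = {f. \<exists>c :: ('n \<Rightarrow> nat) \<Rightarrow> real.
     f = (\<lambda>x. \<Sum>\<alpha>\<in>{\<alpha>. sum \<alpha> UNIV \<le> t}. c \<alpha> * (\<Prod>i\<in>UNIV. (x $ i) ^ \<alpha> i))}"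

definition dimPi :: "nat \<Rightarrow> nat \<Rightarrow> nat" where
  "dimPi d t = (d + t choose t) + (d + t - 1 choose (t - 1))"

end

theory Submission
  imports Defs "HOL-Computational_Algebra.Polynomial"
begin

text \<open>
  The Marcinkiewicz--Zygmund inequality is tested on the zonal function \<open>k (x \<bullet> x\<^sub>t)\<close>, where \<open>k\<close> is the
  Jacobi polynomial of degree \<open>t\<close> with parameters \<open>(d/2, d/2 - 1)\<close> and \<open>k 1 = 1\<close>, a multiple of the
  reproducing kernel of \<open>\<Pi>\<^sub>t\<close>. Its squared norm is \<open>1 / dim \<Pi>\<^sub>t\<close>, and \<open>k \<ge> \<nu>\<close> on the cap because
  \<open>\<bar>k'\<bar> \<le> k' 1 = t (t + d) / (d + 2)\<close> on \<open>[0, 1]\<close>.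

  The only information on the surface measure that enters is its invariance under rotations, which
  determines all zonal moments. That \<open>h\<^sub>d\<close> of the sphere is positive and finite need not be proved:
  otherwise \<open>sphere_L2sq\<close> is identically \<open>0\<close> (division by \<open>0\<close>), and the inequality for the constant
  \<open>1\<close> contradicts the mass of the cap.
\<close>

section \<open>Hausdorff measure\<close>

text \<open>The inner infimum of \<open>hausdorff_outer\<close> at one mesh size
  \<open>\<delta>\<close>. Covering arguments are carried out at fixed \<open>\<delta>\<close>, and
  the supremum is taken afterwards.\<close>

definition hausdorff_pre :: "real \<Rightarrow> real \<Rightarrow> 'a::metric_space set \<Rightarrow> ennreal" where
  "hausdorff_pre s \<delta> E =
     (INF U\<in>{U :: nat \<Rightarrow> 'a set. E \<subseteq> (\<Union>i. U i) \<and>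
          (\<forall>i. bounded (U i) \<and> diameter (U i) \<le> \<delta>)}. (\<Sum>i. hcontrib s (U i)))"

lemma hausdorff_outer_eq_SUP: "hausdorff_outer s E = (SUP \<delta>\<in>{0<..}. hausdorff_pre s \<delta> E)"
  by (simp add: hausdorff_outer_def hausdorff_pre_def)

lemma hausdorff_pre_le_outer: "\<delta> > 0 \<Longrightarrow> hausdorff_pre s \<delta> E \<le> hausdorff_outer s E"
  unfolding hausdorff_outer_eq_SUP by (rule SUP_upper) auto

lemma hausdorff_pre_le:
  "E \<subseteq> (\<Union>i. U i) \<Longrightarrow> (\<And>i. bounded (U i)) \<Longrightarrow> (\<And>i. diameter (U i) \<le> \<delta>)
    \<Longrightarrow> hausdorff_pre s \<delta> E \<le> (\<Sum>i. hcontrib s (U i))"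
  unfolding hausdorff_pre_def by (rule INF_lower) auto

lemma hausdorff_pre_close:
  assumes "hausdorff_pre s \<delta> E < e"
  obtains U where "E \<subseteq> (\<Union>i. U i)" "\<And>i. bounded (U i)" "\<And>i. diameter (U i) \<le> \<delta>"
    "(\<Sum>i. hcontrib s (U i)) < e"
  using assms unfolding hausdorff_pre_def INF_less_iff by auto

section \<open>Monotonicity and subadditivity\<close>

lemma hausdorff_pre_mono: "E \<subseteq> F \<Longrightarrow> hausdorff_pre s \<delta> E \<le> hausdorff_pre s \<delta> F"
  unfolding hausdorff_pre_def by (rule INF_superset_mono) auto

lemma hausdorff_pre_antimono: "\<delta> \<le> \<epsilon> \<Longrightarrow> hausdorff_pre s \<epsilon> E \<le> hausdorff_pre s \<delta> E"
  unfolding hausdorff_pre_def by (rule INF_superset_mono) (auto intro: order_trans)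

lemma hausdorff_outer_mono: "E \<subseteq> F \<Longrightarrow> hausdorff_outer s E \<le> hausdorff_outer s F"
  unfolding hausdorff_outer_eq_SUP by (intro SUP_mono') (auto intro: hausdorff_pre_mono)

lemma hausdorff_outer_empty [simp]: "hausdorff_outer s ({} :: 'a::metric_space set) = 0"
proof -
  have "hausdorff_pre s \<delta> ({} :: 'a set) \<le> (\<Sum>i. hcontrib s ({} :: 'a set))" if "\<delta> > 0" for \<delta> :: real
    using hausdorff_pre_le[of "{} :: 'a set" "\<lambda>_::nat. {}" \<delta> s] that by simp
  then show ?thesis
    unfolding hausdorff_outer_eq_SUP by (intro antisym SUP_least) (auto simp: hcontrib_def)
qed

text \<open>Nearly optimal covers of the \<open>A n\<close>, with errors
  \<open>e * (1/2)^Suc n\<close> that add up to \<open>e\<close>, are merged into one cover of the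
  union.\<close>

lemma hausdorff_pre_countably_subadditive:
  "hausdorff_pre s \<delta> (\<Union>i. A i) \<le> (\<Sum>n. hausdorff_pre s \<delta> (A n))" for A :: "nat \<Rightarrow> _"
proof (rule ennreal_le_epsilon)
  fix e :: real assume e: "0 < e" and fin: "(\<Sum>n. hausdorff_pre s \<delta> (A n)) < top"
  \<comment> \<open>Finiteness of the sum makes every term finite; only then does adding a positive
    error give a strict inequality in \<open>ennreal\<close>.\<close>
  then have "hausdorff_pre s \<delta> (A n) < hausdorff_pre s \<delta> (A n) + e * (1/2)^Suc n" for n
    by (auto simp add: less_top dest!: ennreal_suminf_lessD)
  then have "\<exists>U. A n \<subseteq> (\<Union>i. U i) \<and> (\<forall>i. bounded (U i)) \<and> (\<forall>i. diameter (U i) \<le> \<delta>) \<and>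
      (\<Sum>i. hcontrib s (U i)) \<le> hausdorff_pre s \<delta> (A n) + e * (1/2)^Suc n" for n
    by (metis hausdorff_pre_close less_imp_le)
  then obtain B where B: "\<And>n. A n \<subseteq> (\<Union>i. B n i)" "\<And>n i. bounded (B n i)"
      "\<And>n i. diameter (B n i) \<le> \<delta>"
      "\<And>n. (\<Sum>i. hcontrib s (B n i)) \<le> hausdorff_pre s \<delta> (A n) + e * (1/2)^Suc n"
    by metis
  \<comment> \<open>\<open>prod_decode\<close> lists the doubly indexed covering sets as a single
    sequence.\<close>
  define C where "C = case_prod B o prod_decode"
  have "(\<Union>i. A i) \<subseteq> (\<Union>i. C i)"
    using B(1) by (auto simp add: C_def subset_eq) (metis prod.case prod_encode_inverse)
  then have "hausdorff_pre s \<delta> (\<Union>i. A i) \<le> (\<Sum>i. hcontrib s (C i))"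
    by (intro hausdorff_pre_le) (auto simp: C_def split_def B)
  also have "\<dots> = (\<Sum>n. \<Sum>i. hcontrib s (B n i))"
    unfolding C_def comp_def by (intro suminf_ennreal_2dimen) auto
  also have "\<dots> \<le> (\<Sum>n. hausdorff_pre s \<delta> (A n) + e * (1/2) ^ Suc n)"
    by (intro suminf_le B) auto
  also have "\<dots> = (\<Sum>n. hausdorff_pre s \<delta> (A n)) + (\<Sum>n. ennreal e * ennreal ((1/2) ^ Suc n))"
    using e by (subst suminf_add[symmetric])
       (auto simp del: ennreal_suminf_cmult simp add: ennreal_mult[symmetric])
  also have "\<dots> = (\<Sum>n. hausdorff_pre s \<delta> (A n)) + e"
    unfolding ennreal_suminf_cmult
    by (subst suminf_ennreal_eq[OF zero_le_power power_half_series]) auto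
  finally show "hausdorff_pre s \<delta> (\<Union>i. A i) \<le> (\<Sum>n. hausdorff_pre s \<delta> (A n)) + e" .
qed

lemma hausdorff_outer_countably_subadditive:
  "hausdorff_outer s (\<Union>i. A i) \<le> (\<Sum>n. hausdorff_outer s (A n))" for A :: "nat \<Rightarrow> _"
  unfolding hausdorff_outer_eq_SUP[of s "\<Union>i. A i"]
proof (rule SUP_least)
  fix \<delta> :: real assume "\<delta> \<in> {0<..}"
  then have "(\<Sum>n. hausdorff_pre s \<delta> (A n)) \<le> (\<Sum>n. hausdorff_outer s (A n))"
    by (intro suminf_le hausdorff_pre_le_outer) auto
  with hausdorff_pre_countably_subadditive
  show "hausdorff_pre s \<delta> (\<Union>i. A i) \<le> (\<Sum>n. hausdorff_outer s (A n))"
    by (rule order_trans)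
qed

lemma hausdorff_outer_measure_space: "outer_measure_space UNIV (hausdorff_outer s)"
  unfolding outer_measure_space_def positive_def increasing_def countably_subadditive_def
  using hausdorff_outer_countably_subadditive hausdorff_outer_mono by auto

lemma hausdorff_outer_subadditive:
  "hausdorff_outer s (A \<union> B) \<le> hausdorff_outer s A + hausdorff_outer s B"
proof -
  let ?F = "\<lambda>i::nat. if i = 0 then A else if i = 1 then B else {}"
  have "(\<Union>i. ?F i) = A \<union> B"
    by (auto split: if_splits)
  then have "hausdorff_outer s (A \<union> B) \<le> (\<Sum>i. hausdorff_outer s (?F i))"
    using hausdorff_outer_countably_subadditive[of s ?F] by simp
  also have "\<dots> = (\<Sum>i\<in>{0,1}. hausdorff_outer s (?F i))"
    by (rule suminf_finite) auto
  finally show ?thesis by simp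
qed

section \<open>Caratheodory measurability of Borel sets\<close>

lemma measure_space_hausdorff:
  "measure_space UNIV (lambda_system UNIV UNIV (hausdorff_outer s)) (hausdorff_outer s)"
  using sigma_algebra.caratheodory_lemma[OF sigma_algebra_Pow hausdorff_outer_measure_space[folded Pow_UNIV]]
  by simp

lemma sets_hausdorff_measure:
  "sets (hausdorff_measure s) = lambda_system UNIV UNIV (hausdorff_outer s)"
  unfolding hausdorff_measure_def
  using measure_space_hausdorff[of s]
  by (auto simp: measure_space_def dest: sigma_algebra.sigma_sets_eq)

lemma space_hausdorff_measure [simp]: "space (hausdorff_measure s) = UNIV"
  unfolding hausdorff_measure_def by (rule space_measure_of) auto

lemma emeasure_hausdorff_measure:
  assumes "A \<in> sets (hausdorff_measure s)"
  shows "emeasure (hausdorff_measure s) A = hausdorff_outer s A"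
  using measure_space_hausdorff[of s] assms
  by (intro emeasure_measure_of[OF hausdorff_measure_def]) (auto simp: measure_space_def sets_hausdorff_measure)

lemma sets_hausdorff_measure_iff:
  "A \<in> sets (hausdorff_measure s) \<longleftrightarrow>
    (\<forall>E. hausdorff_outer s (E \<inter> A) + hausdorff_outer s (E - A) = hausdorff_outer s E)"
proof -
  have "A \<inter> E = E \<inter> A" "(UNIV - A) \<inter> E = E - A" for E
    by auto
  then show ?thesis
    by (simp add: sets_hausdorff_measure lambda_system_def)
qed

text \<open>A set of diameter below \<open>e\<close> cannot meet both \<open>P\<close> and
  \<open>Q\<close>, so a fine cover of the union splits into a cover of \<open>P\<close> and a
  disjoint family covering \<open>Q\<close>.\<close>

lemma hausdorff_outer_separated:
  assumes e: "e > 0" and sep: "\<And>x y. x \<in> P \<Longrightarrow> y \<in> Q \<Longrightarrow> e \<le> dist x y"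
  shows "hausdorff_outer s P + hausdorff_outer s Q \<le> hausdorff_outer s (P \<union> Q)"
proof -
  have small: "hausdorff_pre s \<delta> P + hausdorff_pre s \<delta> Q \<le> hausdorff_pre s \<delta> (P \<union> Q)"
    if d: "0 < \<delta>" "\<delta> < e" for \<delta>
    unfolding hausdorff_pre_def[of s \<delta> "P \<union> Q"]
  proof (safe intro!: INF_greatest)
    fix U :: "nat \<Rightarrow> 'a set"
    assume cov: "P \<union> Q \<subseteq> (\<Union>i. U i)" and U: "\<forall>i. bounded (U i) \<and> diameter (U i) \<le> \<delta>"
    \<comment> \<open>Sets that miss \<open>P\<close> are replaced by \<open>{}\<close>, which
      contributes \<open>0\<close> even when \<open>s = 0\<close>.\<close>
    define UP where "UP i = (if U i \<inter> P = {} then {} else U i)" for i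
    define UQ where "UQ i = (if U i \<inter> Q = {} then {} else U i)" for i
    have one: "U i \<inter> P = {} \<or> U i \<inter> Q = {}" for i
    proof (rule ccontr)
      assume "\<not> ?thesis"
      then obtain x y where xy: "x \<in> U i" "x \<in> P" "y \<in> U i" "y \<in> Q" by auto
      then have "dist x y \<le> \<delta>"
        using diameter_bounded_bound[of "U i" x y] U by (meson order_trans)
      with sep[of x y] xy d show False by auto
    qed
    have "hausdorff_pre s \<delta> P \<le> (\<Sum>i. hcontrib s (UP i))"
      using cov U d by (intro hausdorff_pre_le) (auto simp: UP_def subset_eq, blast)
    moreover have "hausdorff_pre s \<delta> Q \<le> (\<Sum>i. hcontrib s (UQ i))"
      using cov U d by (intro hausdorff_pre_le) (auto simp: UQ_def subset_eq, blast)
    ultimately have "hausdorff_pre s \<delta> P + hausdorff_pre s \<delta> Q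
        \<le> (\<Sum>i. hcontrib s (UP i)) + (\<Sum>i. hcontrib s (UQ i))"
      by (rule add_mono)
    also have "\<dots> = (\<Sum>i. hcontrib s (UP i) + hcontrib s (UQ i))"
      by (rule suminf_add) auto
    also have "\<dots> \<le> (\<Sum>i. hcontrib s (U i))"
      using one by (intro suminf_le) (auto simp: UP_def UQ_def hcontrib_def)
    finally show "hausdorff_pre s \<delta> P + hausdorff_pre s \<delta> Q \<le> (\<Sum>i. hcontrib s (U i))" .
  qed
  have "hausdorff_outer s P + hausdorff_outer s Q
      = (SUP \<delta>\<in>{0<..}. hausdorff_pre s \<delta> P + hausdorff_outer s Q)"
    unfolding hausdorff_outer_eq_SUP[of s P] by (rule ennreal_SUP_add_left[symmetric]) auto
  also have "\<dots> \<le> hausdorff_outer s (P \<union> Q)"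
  proof (rule SUP_least)
    fix \<delta> :: real assume d: "\<delta> \<in> {0<..}"
    have "hausdorff_pre s \<delta> P + hausdorff_outer s Q
      = (SUP \<epsilon>\<in>{0<..}. hausdorff_pre s \<delta> P + hausdorff_pre s \<epsilon> Q)"
      unfolding hausdorff_outer_eq_SUP[of s Q] by (subst ennreal_SUP_add_right) auto
    also have "\<dots> \<le> hausdorff_outer s (P \<union> Q)"
    proof (rule SUP_least)
      fix \<epsilon> :: real assume "\<epsilon> \<in> {0<..}"
      \<comment> \<open>A common mesh, finer than both given ones and below \<open>e\<close>, where
        \<open>small\<close> applies; refining the mesh only increases
        \<open>hausdorff_pre\<close>.\<close>
      define \<eta> where "\<eta> = min (min \<delta> \<epsilon>) (e/2)"
      have \<eta>: "0 < \<eta>" "\<eta> < e" "\<eta> \<le> \<delta>" "\<eta> \<le> \<epsilon>"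
        using d e \<open>\<epsilon> \<in> _\<close> by (auto simp: \<eta>_def)
      have "hausdorff_pre s \<delta> P + hausdorff_pre s \<epsilon> Q \<le> hausdorff_pre s \<eta> P + hausdorff_pre s \<eta> Q"
        using \<eta> by (intro add_mono hausdorff_pre_antimono) auto
      also have "\<dots> \<le> hausdorff_pre s \<eta> (P \<union> Q)"
        by (rule small) (use \<eta> in auto)
      also have "\<dots> \<le> hausdorff_outer s (P \<union> Q)"
        by (rule hausdorff_pre_le_outer) (use \<eta> in auto)
      finally show "hausdorff_pre s \<delta> P + hausdorff_pre s \<epsilon> Q \<le> hausdorff_outer s (P \<union> Q)" .
    qed
    finally show "hausdorff_pre s \<delta> P + hausdorff_outer s Q \<le> hausdorff_outer s (P \<union> Q)" .
  qed
  finally show ?thesis .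
qed

text \<open>A finite total forces finite terms, which reduces the claim to the tails of a summable
  real series.\<close>

lemma ennreal_suminf_tail_tendsto_0:
  fixes f :: "nat \<Rightarrow> ennreal"
  assumes "(\<Sum>i. f i) < top"
  shows "(\<lambda>n. \<Sum>i. f (i + n)) \<longlonglongrightarrow> 0"
proof -
  have f: "f i = ennreal (enn2real (f i))" for i
    using ennreal_suminf_lessD[OF assms, of i] by simp
  have sm: "summable (\<lambda>i. enn2real (f i))"
    using assms f by (intro summable_suminf_not_top) (auto simp flip: f)
  have "(\<lambda>n. ennreal (\<Sum>i. enn2real (f (i + n)))) \<longlonglongrightarrow> ennreal 0"
    by (intro tendsto_ennrealI suminf_exist_split2 sm)
  moreover have "ennreal (\<Sum>i. enn2real (f (i + n))) = (\<Sum>i. f (i + n))" for n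
    by (subst suminf_ennreal2[symmetric])
       (auto simp flip: f intro!: summable_iff_shift[THEN iffD2] sm)
  ultimately show ?thesis by simp
qed

text \<open>Caratheodory's criterion for metric outer measures: the part of \<open>A\<close> near \<open>C\<close> is cut into
  layers according to the distance to \<open>C\<close>; layers of equal parity are separated, so the outer
  measures of the layers are summable.\<close>
lemma closed_in_sets_hausdorff:
  assumes C: "closed C"
  shows "C \<in> sets (hausdorff_measure s)"
proof (cases "C = {}")
  case False
  let ?h = "hausdorff_outer s"
  have "?h (A \<inter> C) + ?h (A - C) \<le> ?h A" if fin: "?h A < top" for A
  proof -
    define B where "B n = {x \<in> A. 1 / real (Suc n) \<le> infdist x C}" for n
    define D where "D n = B (Suc n) - B n" for n
    have infdist_diff: "infdist x C - infdist y C \<le> dist x y" for x y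
      using infdist_triangle[of x C y] by simp
    have Bmono: "B m \<subseteq> B n" if "m \<le> n" for m n
    proof -
      have "1 / real (Suc n) \<le> 1 / real (Suc m)"
        using that by (intro divide_left_mono) auto
      then show ?thesis by (auto simp: B_def)
    qed
    have lt: "1 / real (Suc (Suc n)) < 1 / real (Suc n)" for n
      by (auto intro!: divide_strict_left_mono)
    \<comment> \<open>A point of \<open>D (Suc n)\<close> lies outside \<open>B (Suc n)\<close>, so
      its distance to \<open>C\<close> is below \<open>1 / (n + 2)\<close>, while on
      \<open>B n\<close> that distance is at least \<open>1 / (n + 1)\<close>. Consecutive layers
      have no such gap, hence the split by parity.\<close>
    have sepB: "?h (B n) + ?h (D (Suc n)) \<le> ?h (B n \<union> D (Suc n))" for n
    proof (rule hausdorff_outer_separated)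
      show "0 < 1 / real (Suc n) - 1 / real (Suc (Suc n))"
        using lt[of n] by simp
      show "1 / real (Suc n) - 1 / real (Suc (Suc n)) \<le> dist x y" if "x \<in> B n" "y \<in> D (Suc n)" for x y
        using that infdist_diff[of x y] by (auto simp: B_def D_def)
    qed
    \<comment> \<open>The values \<open>p = 0\<close> and \<open>p = 1\<close> give the odd and the
      even layers. Each new layer is separated from the set \<open>B (2 * n + p)\<close> that
      contains the earlier ones.\<close>
    have parity: "(\<Sum>k<n. ?h (D (2 * k + p + 1))) \<le> ?h A" for n p
    proof -
      have "(\<Sum>k<n. ?h (D (2 * k + p + 1))) \<le> ?h (B (2 * n + p))"
      proof (induction n)
        case (Suc n)
        have "(\<Sum>k<Suc n. ?h (D (2 * k + p + 1))) \<le> ?h (B (2 * n + p)) + ?h (D (Suc (2 * n + p)))"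
          using Suc by (simp add: add_right_mono)
        also have "\<dots> \<le> ?h (B (2 * n + p) \<union> D (Suc (2 * n + p)))"
          by (rule sepB)
        also have "\<dots> \<le> ?h (B (2 * Suc n + p))"
          using Bmono[of "2 * n + p" "2 * Suc n + p"]
          by (intro hausdorff_outer_mono) (auto simp: D_def)
        finally show ?case .
      qed simp
      also have "\<dots> \<le> ?h A"
        by (rule hausdorff_outer_mono) (auto simp: B_def)
      finally show ?thesis .
    qed
    have "(\<Sum>k. ?h (D (k + 1))) \<le> ?h A + ?h A"
    proof (rule suminf_le_const)
      fix n
      have "(\<Sum>k<n. ?h (D (k + 1))) \<le> (\<Sum>k<2 * n. ?h (D (k + 1)))"
        by (rule sum_mono2) auto
      also have "\<dots> = (\<Sum>k<n. ?h (D (2 * k + 0 + 1))) + (\<Sum>k<n. ?h (D (2 * k + 1 + 1)))"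
        by (induction n) (auto simp: algebra_simps)
      also have "\<dots> \<le> ?h A + ?h A"
        by (intro add_mono parity)
      finally show "(\<Sum>k<n. ?h (D (k + 1))) \<le> ?h A + ?h A" .
    qed auto
    also have "\<dots> < top"
      using fin by simp
    finally have tail: "(\<lambda>n. \<Sum>k. ?h (D (k + n + 1))) \<longlonglongrightarrow> 0"
      using ennreal_suminf_tail_tendsto_0[of "\<lambda>k. ?h (D (k + 1))"] by (simp add: add.commute add.left_commute)
    have bound: "?h (A \<inter> C) + ?h (A - C) \<le> ?h A + (\<Sum>k. ?h (D (k + n + 1)))" for n
    proof -
      have "A - C \<subseteq> B (n + 1) \<union> (\<Union>k. D (k + n + 1))"
      proof
        fix x assume x: "x \<in> A - C"
        then have "0 < infdist x C"
          using C False by (simp add: infdist_pos_not_in_closed)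
        then obtain m where "1 / real (Suc m) < infdist x C"
          using reals_Archimedean by (auto simp: inverse_eq_divide)
        then have "x \<in> B m"
          using x by (auto simp: B_def)
        then have "x \<in> B (m + n + 1)"
          using Bmono[of m "m + n + 1"] by auto
        then have "x \<in> B (n + 1) \<union> (\<Union>k<m. D (k + n + 1))"
        proof (induction m)
          case (Suc m)
          show ?case
          proof (cases "x \<in> B (m + n + 1)")
            case True
            with Suc.IH show ?thesis by (auto simp: less_Suc_eq)
          next
            case False
            with Suc.prems have "x \<in> D (m + n + 1)"
              by (auto simp: D_def)
            then show ?thesis by auto
          qed
        qed simp
        then show "x \<in> B (n + 1) \<union> (\<Union>k. D (k + n + 1))" by auto
      qed
      then have "?h (A - C) \<le> ?h (B (n + 1) \<union> (\<Union>k. D (k + n + 1)))"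
        by (rule hausdorff_outer_mono)
      also have "\<dots> \<le> ?h (B (n + 1)) + ?h (\<Union>k. D (k + n + 1))"
        by (rule hausdorff_outer_subadditive)
      also have "\<dots> \<le> ?h (B (n + 1)) + (\<Sum>k. ?h (D (k + n + 1)))"
        by (intro add_left_mono hausdorff_outer_countably_subadditive)
      finally have "?h (A \<inter> C) + ?h (A - C)
          \<le> (?h (A \<inter> C) + ?h (B (n + 1))) + (\<Sum>k. ?h (D (k + n + 1)))"
        by (simp add: add_left_mono add.assoc)
      moreover have "?h (A \<inter> C) + ?h (B (n + 1)) \<le> ?h ((A \<inter> C) \<union> B (n + 1))"
      proof (rule hausdorff_outer_separated)
        show "1 / real (Suc (n + 1)) \<le> dist x y" if "x \<in> A \<inter> C" "y \<in> B (n + 1)" for x y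
          using that infdist_le[of x C y] by (auto simp: B_def dist_commute)
      qed simp
      moreover have "?h ((A \<inter> C) \<union> B (n + 1)) \<le> ?h A"
        by (rule hausdorff_outer_mono) (auto simp: B_def)
      ultimately show ?thesis
        by (meson add_right_mono order_trans)
    qed
    have "(\<lambda>n. ?h A + (\<Sum>k. ?h (D (k + n + 1)))) \<longlonglongrightarrow> ?h A + 0"
      by (intro tendsto_add tail tendsto_const)
    then show ?thesis
      using bound by (intro LIMSEQ_le_const) auto
  qed
  then have le: "?h (A \<inter> C) + ?h (A - C) \<le> ?h A" for A
    by (cases "?h A = top") (auto simp: less_top)
  moreover have "?h A \<le> ?h (A \<inter> C) + ?h (A - C)" for A
    using hausdorff_outer_subadditive[of s "A \<inter> C" "A - C"] by (simp add: Int_Diff_Un)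
  ultimately show ?thesis
    by (auto simp: sets_hausdorff_measure_iff intro: antisym)
qed simp

lemma borel_subset_sets_hausdorff: "sets borel \<subseteq> sets (hausdorff_measure s :: 'a::metric_space measure)"
  unfolding borel_eq_closed
  using sets.sigma_sets_subset[of "Collect closed" "hausdorff_measure s :: 'a measure"]
  by (simp add: closed_in_sets_hausdorff subset_eq)

lemma borel_measurable_hausdorff:
  "f \<in> borel_measurable borel \<Longrightarrow> f \<in> borel_measurable (hausdorff_measure s)"
  using borel_subset_sets_hausdorff[of s] by (auto simp: measurable_def)

section \<open>Invariance under isometries\<close>

lemma hausdorff_outer_isometry_image_le:
  fixes f :: "'a::metric_space \<Rightarrow> 'b::metric_space"
  assumes iso: "\<And>x y. dist (f x) (f y) = dist x y"
  shows "hausdorff_outer s (f ` E) \<le> hausdorff_outer s E"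
proof -
  have diam: "diameter (f ` U) = diameter U" for U
  proof -
    have "(\<lambda>(x, y). dist x y) ` (f ` U \<times> f ` U) = (\<lambda>(x, y). dist x y) ` (U \<times> U)"
      by (force simp: iso image_iff)
    then show ?thesis by (simp add: diameter_def)
  qed
  have "hausdorff_pre s \<delta> (f ` E) \<le> hausdorff_pre s \<delta> E" for \<delta>
    unfolding hausdorff_pre_def[of s \<delta> E]
  proof (safe intro!: INF_greatest)
    fix U :: "nat \<Rightarrow> 'a set"
    assume cov: "E \<subseteq> (\<Union>i. U i)" and U: "\<forall>i. bounded (U i) \<and> diameter (U i) \<le> \<delta>"
    have "f ` E \<subseteq> (\<Union>i. f ` U i)"
      using cov by blast
    moreover have "bounded (f ` U i)" for i
      using U unfolding bounded_def by (auto simp: iso) (metis iso)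
    ultimately have "hausdorff_pre s \<delta> (f ` E) \<le> (\<Sum>i. hcontrib s (f ` U i))"
      using U by (intro hausdorff_pre_le) (auto simp: diam)
    moreover have "hcontrib s (f ` U i) = hcontrib s (U i)" for i
      by (simp add: hcontrib_def diam)
    ultimately show "hausdorff_pre s \<delta> (f ` E) \<le> (\<Sum>i. hcontrib s (U i))"
      by simp
  qed
  then show ?thesis
    unfolding hausdorff_outer_eq_SUP by (intro SUP_mono') auto
qed

lemma hausdorff_outer_isometry_vimage:
  fixes f :: "'a::metric_space \<Rightarrow> 'a"
  assumes iso: "\<And>x y. dist (f x) (f y) = dist x y" and "surj f"
  shows "hausdorff_outer s (f -` E) = hausdorff_outer s E"
proof (rule antisym)
  have inj: "inj f"
    using iso by (auto intro!: injI) (metis dist_eq_0_iff)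
  have "dist (inv f x) (inv f y) = dist x y" for x y
    using iso[of "inv f x" "inv f y"] \<open>surj f\<close> by (simp add: surj_f_inv_f)
  from hausdorff_outer_isometry_image_le[of "inv f", OF this, of s E]
  show "hausdorff_outer s (f -` E) \<le> hausdorff_outer s E"
    using inj \<open>surj f\<close> by (simp add: bij_vimage_eq_inv_image bij_def)
  show "hausdorff_outer s E \<le> hausdorff_outer s (f -` E)"
    using hausdorff_outer_isometry_image_le[of f s "f -` E", OF iso] \<open>surj f\<close>
    by (simp add: surj_image_vimage_eq)
qed

text \<open>A surjective isometry preserves the outer measure, so it transports Caratheodory's
  condition, and with it the measure.\<close>

lemma distr_hausdorff_measure_isometry:
  fixes f :: "'a::metric_space \<Rightarrow> 'a"
  assumes iso: "\<And>x y. dist (f x) (f y) = dist x y" and surj: "surj f"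
  shows "f \<in> measurable (hausdorff_measure s) (hausdorff_measure s)"
    and "distr (hausdorff_measure s) (hausdorff_measure s) f = hausdorff_measure s"
proof -
  note inv = hausdorff_outer_isometry_vimage[of f, OF iso surj]
  show meas: "f \<in> measurable (hausdorff_measure s) (hausdorff_measure s)"
  proof (rule measurableI)
    fix A assume A: "A \<in> sets (hausdorff_measure s :: 'a measure)"
    have "hausdorff_outer s (E \<inter> f -` A) + hausdorff_outer s (E - f -` A) = hausdorff_outer s E" for E
    proof -
      have "inj f"
        using iso by (auto intro!: injI) (metis dist_eq_0_iff)
      \<comment> \<open>With \<open>E\<close> written as a preimage, the condition for the preimage
        of \<open>A\<close> tested on \<open>E\<close> becomes the condition for \<open>A\<close>
        tested on the image of \<open>E\<close>.\<close>
      then have "E = f -` (f ` E)"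
        by (simp add: inj_vimage_image_eq)
      then show ?thesis
        using A inv[of s "f ` E"] inv[of s "f ` E \<inter> A"] inv[of s "f ` E - A"]
        by (simp add: sets_hausdorff_measure_iff vimage_Int vimage_Diff)
    qed
    then show "f -` A \<inter> space (hausdorff_measure s) \<in> sets (hausdorff_measure s)"
      by (simp add: sets_hausdorff_measure_iff)
  qed simp
  show "distr (hausdorff_measure s) (hausdorff_measure s) f = hausdorff_measure s"
  proof (rule measure_eqI)
    fix A assume "A \<in> sets (distr (hausdorff_measure s) (hausdorff_measure s) f)"
    then have A: "A \<in> sets (hausdorff_measure s)" by simp
    have "f -` A \<in> sets (hausdorff_measure s)"
      using measurable_sets[OF meas A] by simp
    with A meas show "emeasure (distr (hausdorff_measure s) (hausdorff_measure s) f) A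
        = emeasure (hausdorff_measure s) A"
      by (simp add: emeasure_distr emeasure_hausdorff_measure inv)
  qed simp
qed

section \<open>The zonal kernel polynomial\<close>

text \<open>The Jacobi polynomial \<open>P\<^sub>t\<close> with parameters \<open>(d/2, d/2 - 1)\<close>, normalised to be \<open>1\<close> at
  \<open>u = 1\<close> and expanded in powers of \<open>v = 1 - u\<close>.\<close>

definition jacobi_coeff :: "nat \<Rightarrow> nat \<Rightarrow> nat \<Rightarrow> real" where
  "jacobi_coeff d t j =
     (\<Prod>i<j. (real i * (real i + real d) - real t * (real t + real d))
              / ((real i + 1) * (2 * real i + real d + 2)))"

definition jacobi_poly :: "nat \<Rightarrow> nat \<Rightarrow> real poly" where
  "jacobi_poly d t = (\<Sum>j\<le>t. monom (jacobi_coeff d t j) j)"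

lemma jacobi_coeff_0 [simp]: "jacobi_coeff d t 0 = 1"
  by (simp add: jacobi_coeff_def)

text \<open>Since \<open>i (i + d) - t (t + d) = (i - t) (i + t + d)\<close>, this is the
  coefficient recursion of the hypergeometric polynomial
  \<open>2F1(-t, t + d; d/2 + 1; v/2)\<close>, with denominators cleared.\<close>

lemma jacobi_coeff_Suc:
  "(real j + 1) * (2 * real j + real d + 2) * jacobi_coeff d t (Suc j)
    = (real j * (real j + real d) - real t * (real t + real d)) * jacobi_coeff d t j"
proof -
  have "2 * real j + real d + 2 \<noteq> 0" "real j + 1 \<noteq> 0"
    by linarith+
  then show ?thesis
    by (simp add: jacobi_coeff_def)
qed

lemma jacobi_coeff_eq_0: "t < j \<Longrightarrow> jacobi_coeff d t j = 0"
  unfolding jacobi_coeff_def by (rule prod_zero) (auto intro!: bexI[of _ t])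

lemma coeff_jacobi_poly [simp]: "coeff (jacobi_poly d t) j = jacobi_coeff d t j"
proof -
  have "coeff (jacobi_poly d t) j = (\<Sum>i\<le>t. if i = j then jacobi_coeff d t i else 0)"
    by (simp add: jacobi_poly_def coeff_sum)
  also have "\<dots> = jacobi_coeff d t j"
    by (simp add: jacobi_coeff_eq_0)
  finally show ?thesis .
qed

lemma poly_jacobi_poly_0 [simp]: "poly (jacobi_poly d t) 0 = 1"
  by (simp add: poly_0_coeff_0)

lemma poly_jacobi_poly: "poly (jacobi_poly d t) v = (\<Sum>j\<le>t. jacobi_coeff d t j * v ^ j)"
  by (simp add: jacobi_poly_def poly_sum poly_monom)

text \<open>The Jacobi differential operator \<open>v (2 - v) p'' + (d + 2 - (d + 1) v) p'\<close>
  in the variable \<open>v = 1 - u\<close>. It is symmetric for the zonal weight of the sphere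
  multiplied by \<open>v\<close>.\<close>

definition jacobi_op :: "nat \<Rightarrow> real poly \<Rightarrow> real poly" where
  "jacobi_op d p = [:0, 2, -1:] * pderiv (pderiv p)
      + [:real d + 2, - (real d + 1):] * pderiv p"

lemma coeff_jacobi_op:
  "coeff (jacobi_op d p) j = (real j + 1) * (2 * real j + real d + 2) * coeff p (Suc j)
     - real j * (real j + real d) * coeff p j"
  by (cases j; cases "j - 1")
     (auto simp: jacobi_op_def coeff_pderiv coeff_pCons algebra_simps)

lemma jacobi_op_jacobi_poly:
  "jacobi_op d (jacobi_poly d t) = smult (- (real t * (real t + real d))) (jacobi_poly d t)"
  using jacobi_coeff_Suc[of _ d t]
  by (intro poly_eqI) (simp add: coeff_jacobi_op algebra_simps)

text \<open>The operator is triangular on monomials, which drives the induction in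
  \<open>jacobi_poly_orthogonal\<close>.\<close>

lemma jacobi_op_monom:
  "jacobi_op d (monom 1 (Suc n)) = smult (real (Suc n) * (2 * real (Suc n) + real d)) (monom 1 n)
     - smult (real (Suc n) * (real (Suc n) + real d)) (monom 1 (Suc n))"
  by (intro poly_eqI) (auto simp: coeff_jacobi_op algebra_simps)

text \<open>Sonin's argument, applied to the derivative: the function
  \<open>\<mu> p'\<^sup>2 + v (2 - v) p''\<^sup>2\<close> decreases on \<open>[0, 1]\<close>.\<close>
lemma abs_pderiv_jacobi_poly_le:
  assumes t: "t \<ge> 1" and v: "0 \<le> v" "v \<le> 1"
  shows "\<bar>poly (pderiv (jacobi_poly d t)) v\<bar> \<le> real t * (real t + real d) / (real d + 2)"
proof -
  let ?k = "jacobi_poly d t"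
  define p1 where "p1 = pderiv ?k"
  define p2 where "p2 = pderiv p1"
  define p3 where "p3 = pderiv p2"
  define \<mu> where "\<mu> = real t * (real t + real d) - (real d + 1)"
  have ode: "[:0, 2, -1:] * p2 + [:real d + 2, - (real d + 1):] * p1
      + smult (real t * (real t + real d)) ?k = 0"
    using jacobi_op_jacobi_poly[of d t] by (simp add: jacobi_op_def p1_def p2_def)
  \<comment> \<open>The derivative of the eigenvalue equation; \<open>\<mu>\<close> is the
    coefficient that \<open>p1\<close> acquires there.\<close>
  have ode1: "(2 * x - x\<^sup>2) * poly p3 x + (real d + 4 - (real d + 3) * x) * poly p2 x + \<mu> * poly p1 x = 0"
    for x
  proof -
    have "poly (pderiv ([:0, 2, -1:] * p2 + [:real d + 2, - (real d + 1):] * p1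
      + smult (real t * (real t + real d)) ?k)) x = 0"
      by (subst ode) simp
    then show ?thesis
      by (simp add: pderiv_add pderiv_minus pderiv_mult pderiv_smult pderiv_pCons flip: p1_def p2_def p3_def)
         (simp add: algebra_simps power2_eq_square \<mu>_def)
  qed
  have p1_0: "poly p1 0 = - (real t * (real t + real d) / (real d + 2))"
    using jacobi_coeff_Suc[of 0 d t]
    by (simp add: p1_def poly_0_coeff_0 coeff_pderiv field_simps)
  have nn: "0 \<le> real t * (real t + real d) / (real d + 2)"
    by simp
  have "\<bar>poly p1 v\<bar> \<le> \<bar>poly p1 0\<bar>"
  \<comment> \<open>For \<open>t = 1\<close> the constant \<open>\<mu>\<close> is \<open>0\<close>
    and cannot be divided out, but then \<open>p1\<close> is constant.\<close>
  proof (cases "t = 1")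
    case True
    have "p2 = 0"
      using True by (intro poly_eqI) (simp add: p2_def p1_def coeff_pderiv jacobi_coeff_eq_0)
    then obtain c where "p1 = [:c:]"
      unfolding p2_def pderiv_eq_0_iff by (metis degree_eq_zeroE)
    then show ?thesis by simp
  next
    case False
    then have "\<mu> = (real t - 1) * (real t + real d + 1)" and "real t > 1"
      using t by (auto simp: \<mu>_def algebra_simps)
    then have \<mu>: "\<mu> > 0" by simp
    define F where "F x = \<mu> * (poly p1 x)\<^sup>2 + (2 * x - x\<^sup>2) * (poly p2 x)\<^sup>2" for x
    have "F v \<le> F 0"
    proof (rule DERIV_nonpos_imp_nonincreasing[OF v(1)])
      fix x assume x: "0 \<le> x" "x \<le> v"
      have "(F has_real_derivative 2 * poly p2 x * (\<mu> * poly p1 x + (1 - x) * poly p2 x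
          + (2 * x - x\<^sup>2) * poly p3 x)) (at x)"
        unfolding F_def
        by (auto intro!: derivative_eq_intros poly_DERIV simp: power2_eq_square
            simp flip: p2_def p3_def) (simp add: algebra_simps)
      \<comment> \<open>\<open>ode1\<close> eliminates \<open>p3\<close>, and what remains is a
        negative multiple of the square of \<open>p2\<close> for \<open>x \<le> 1\<close>.\<close>
      moreover have "2 * poly p2 x * (\<mu> * poly p1 x + (1 - x) * poly p2 x
          + (2 * x - x\<^sup>2) * poly p3 x) = - 2 * (poly p2 x)\<^sup>2 * (real d + 3 - (real d + 2) * x)"
        using ode1[of x] by algebra
      moreover have "(real d + 2) * x \<le> real d + 2"
        using mult_left_mono[of x 1 "real d + 2"] x v by simp
      then have "0 \<le> real d + 3 - (real d + 2) * x"
        by linarith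
      then have "- 2 * (poly p2 x)\<^sup>2 * (real d + 3 - (real d + 2) * x) \<le> 0"
        by (intro mult_nonpos_nonneg) auto
      ultimately show "\<exists>y. (F has_real_derivative y) (at x) \<and> y \<le> 0"
        by metis
    qed
    moreover have "0 \<le> (2 * v - v\<^sup>2) * (poly p2 v)\<^sup>2"
    proof -
      have "0 \<le> 2 * v - v\<^sup>2"
        using v mult_nonneg_nonneg[of v "2 - v"] by (simp add: power2_eq_square algebra_simps)
      then show ?thesis by simp
    qed
    ultimately have "\<mu> * (poly p1 v)\<^sup>2 \<le> \<mu> * (poly p1 0)\<^sup>2"
      by (simp add: F_def)
    with \<mu> show ?thesis by (simp add: abs_le_square_iff)
  qed
  then show ?thesis
    using p1_0 nn by (simp add: p1_def)
qed

text \<open>Mean value theorem from the value \<open>1\<close> at \<open>v = 0\<close>, with the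
  derivative bound above.\<close>

lemma jacobi_poly_ge:
  assumes t: "t \<ge> 1" and v: "0 \<le> v" "v \<le> 1"
  shows "1 - v * (real t * (real t + real d) / (real d + 2)) \<le> poly (jacobi_poly d t) v"
proof (cases "v = 0")
  case False
  then have "0 < v" using v by simp
  from MVT2[OF this, of "poly (jacobi_poly d t)" "poly (pderiv (jacobi_poly d t))"]
  obtain z where z: "0 < z" "z < v"
    "poly (jacobi_poly d t) v - 1 = v * poly (pderiv (jacobi_poly d t)) z"
    by (auto intro: poly_DERIV)
  have "- (real t * (real t + real d) / (real d + 2)) \<le> poly (pderiv (jacobi_poly d t)) z"
    using abs_pderiv_jacobi_poly_le[OF t, of z d] z v by linarith
  then have "v * - (real t * (real t + real d) / (real d + 2)) \<le> v * poly (pderiv (jacobi_poly d t)) z"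
    using v by (intro mult_left_mono) auto
  with z show ?thesis by simp
qed simp

text \<open>For the moments of \<open>v = 1 - x \<bullet> e\<close> on the sphere, assumption \<open>ibp\<close> is integration by parts.\<close>
locale zonal_functional =
  fixes d :: nat and L :: "real poly \<Rightarrow> real"
  assumes d1: "d \<ge> 1"
    and L_add: "L (p + q) = L p + L q"
    and L_smult: "L (smult c p) = c * L p"
    and L_1: "L 1 = 1"
    and ibp: "L ([:0, 2, -1:] * pderiv g + smult (real d) ([:1, -1:] * g)) = 0"
begin

lemma L_0 [simp]: "L 0 = 0"
  using L_smult[of 0 0] by simp

lemma L_minus: "L (- p) = - L p"
  using L_smult[of "-1" p] by simp

lemma L_diff: "L (p - q) = L p - L q"
  using L_add[of p "- q"] by (simp add: L_minus)

lemma L_sum: "L (\<Sum>i\<in>I. f i) = (\<Sum>i\<in>I. L (f i))"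
  by (induction I rule: infinite_finite_induct) (auto simp: L_add)

text \<open>Integration by parts turns both sides into the same Dirichlet form in
  \<open>pderiv p\<close> and \<open>pderiv q\<close>; the test polynomial for \<open>ibp\<close> is
  \<open>v p' q\<close>.\<close>

lemma jacobi_op_symmetric:
  "L ([:0, 1:] * (q * jacobi_op d p)) = L ([:0, 1:] * (p * jacobi_op d q))"
proof -
  have "L ([:0, 1:] * (q * jacobi_op d p)) = - L ([:0, 1:] * ([:0, 2, -1:] * (pderiv p * pderiv q)))"
    for p q
  proof -
    have "[:0, 2, -1:] * pderiv ([:0, 1:] * (pderiv p * q)) + smult (real d) ([:1, -1:] * ([:0, 1:] * (pderiv p * q)))
        = [:0, 1:] * (q * jacobi_op d p) + [:0, 1:] * ([:0, 2, -1:] * (pderiv p * pderiv q))"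
      by (rule poly_ext) (simp add: jacobi_op_def pderiv_mult pderiv_pCons algebra_simps)
    with ibp[of "[:0, 1:] * (pderiv p * q)"] show ?thesis
      by (simp only: L_add)
  qed
  from this[of q p] this[of p q] show ?thesis
    by (simp only: mult.commute[of "pderiv q" "pderiv p"])
qed

text \<open>An eigenvector of a symmetric operator is tested against monomials. Triangularity leaves
  only a multiple of the previous case, and the eigenvalues \<open>n (n + d)\<close> and
  \<open>t (t + d)\<close> differ for \<open>n < t\<close>.\<close>

lemma jacobi_poly_orthogonal:
  "n < t \<Longrightarrow> L ([:0, 1:] * (jacobi_poly d t * monom 1 n)) = 0"
proof (induction n)
  case 0
  let ?k = "jacobi_poly d t" and ?X = "[:0, 1:] :: real poly"
  have "L (?X * (?k * jacobi_op d 1)) = L (?X * (1 * jacobi_op d ?k))"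
    by (rule jacobi_op_symmetric)
  moreover have "jacobi_op d 1 = 0"
    by (simp add: jacobi_op_def)
  moreover have "?X * (1 * jacobi_op d ?k) = smult (- (real t * (real t + real d))) (?X * ?k)"
    by (simp add: jacobi_op_jacobi_poly)
  ultimately have "real t * (real t + real d) * L (?X * ?k) = 0"
    by (simp only: L_smult) simp
  then show ?case
    using 0 by simp
next
  case (Suc n)
  let ?k = "jacobi_poly d t" and ?X = "[:0, 1:] :: real poly"
  let ?l = "\<lambda>n. real n * (real n + real d)"
  have "L (?X * (?k * jacobi_op d (monom 1 (Suc n)))) = L (?X * (monom 1 (Suc n) * jacobi_op d ?k))"
    by (rule jacobi_op_symmetric)
  also have "?X * (monom 1 (Suc n) * jacobi_op d ?k) = smult (- ?l t) (?X * (?k * monom 1 (Suc n)))"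
    by (rule poly_ext) (simp add: jacobi_op_jacobi_poly)
  also have "?X * (?k * jacobi_op d (monom 1 (Suc n)))
     = smult (real (Suc n) * (2 * real (Suc n) + real d)) (?X * (?k * monom 1 n))
       - smult (?l (Suc n)) (?X * (?k * monom 1 (Suc n)))"
    unfolding jacobi_op_monom by (rule poly_ext) (simp add: poly_monom algebra_simps)
  finally have "(?l t - ?l (Suc n)) * L (?X * (?k * monom 1 (Suc n)))
      = - (real (Suc n) * (2 * real (Suc n) + real d)) * L (?X * (?k * monom 1 n))"
    unfolding L_diff L_smult by algebra
  then have "(?l t - ?l (Suc n)) * L (?X * (?k * monom 1 (Suc n))) = 0"
    using Suc by (simp del: mult_pCons_left)
  moreover have "?l (Suc n) < ?l t"
    using Suc.prems by (intro mult_strict_mono) auto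
  ultimately show ?case by simp
qed

text \<open>The reproducing property: the kernel minus its value \<open>1\<close> at
  \<open>v = 0\<close> is \<open>v\<close> times a polynomial of degree below \<open>t\<close>, and
  the kernel is orthogonal to that product.\<close>

lemma L_jacobi_poly_square: "L (jacobi_poly d t * jacobi_poly d t) = L (jacobi_poly d t)"
proof -
  let ?k = "jacobi_poly d t" and ?X = "[:0, 1:] :: real poly"
  have k: "?k = 1 + (\<Sum>j<t. smult (jacobi_coeff d t (Suc j)) (?X * monom 1 j))"
    by (rule poly_ext)
       (simp add: poly_jacobi_poly poly_sum poly_monom lessThan_Suc_atMost[symmetric]
          sum.lessThan_Suc_shift mult_ac del: sum.lessThan_Suc)
  have "?k * ?k = ?k * (1 + (\<Sum>j<t. smult (jacobi_coeff d t (Suc j)) (?X * monom 1 j)))"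
    using k by metis
  also have "\<dots> = ?k + (\<Sum>j<t. smult (jacobi_coeff d t (Suc j)) (?X * (?k * monom 1 j)))"
    by (rule poly_ext) (simp add: poly_sum sum_distrib_left algebra_simps)
  finally have "L (?k * ?k)
      = L (?k + (\<Sum>j<t. smult (jacobi_coeff d t (Suc j)) (?X * (?k * monom 1 j))))"
    by (rule arg_cong)
  also have "\<dots> = L ?k"
    by (simp only: L_add L_sum L_smult) (simp add: jacobi_poly_orthogonal del: mult_pCons_left)
  finally show ?thesis .
qed

text \<open>This is \<open>ibp\<close> at \<open>g = v^j\<close>. With \<open>L 1 = 1\<close> it
  determines all moments: \<open>v / 2\<close> has those of the Beta distribution with parameters
  \<open>d/2, d/2\<close>.\<close>

lemma L_monom_Suc: "(real j + real d) * L (monom 1 (Suc j)) = (2 * real j + real d) * L (monom 1 j)"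
proof -
  have "[:0, 2, -1:] * pderiv (monom 1 j) + smult (real d) ([:1, -1:] * monom 1 j)
      = smult (2 * real j + real d) (monom 1 j) - smult (real j + real d) (monom 1 (Suc j))"
    by (rule poly_ext, cases j) (simp_all add: pderiv_monom poly_monom algebra_simps)
  with ibp[of "monom 1 j"] show ?thesis
    by (simp only: L_diff L_smult)
qed

lemma L_jacobi_poly: "L (jacobi_poly d t) = (\<Sum>j\<le>t. jacobi_coeff d t j * L (monom 1 j))"
proof -
  have "jacobi_poly d t = (\<Sum>j\<le>t. smult (jacobi_coeff d t j) (monom 1 j))"
    by (simp add: jacobi_poly_def smult_monom)
  then show ?thesis by (simp add: L_sum L_smult)
qed

text \<open>The sum in \<open>L_jacobi_poly\<close> is Saalschuetzian and is evaluated by a telescoping certificate \<open>G\<close>.\<close>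
lemma L_jacobi_poly_Suc:
  "(real d + 2 * real t + 2) * (real d + real t) * L (jacobi_poly d (Suc t))
     = (real d + 2 * real t) * (real t + 1) * L (jacobi_poly d t)"
proof -
  define T where "T j = jacobi_coeff d (Suc t) j * L (monom 1 j)" for j
  \<comment> \<open>The factor \<open>real j\<close> gives \<open>G 0 = 0\<close>, and
    \<open>T (t + 2) = 0\<close> removes the upper end, so the telescoped sum vanishes.\<close>
  define G where "G j = - (real d + 2 * real t + 1) * real j * (2 * real j + real d)
      * (real j + real d - 1) * T j / ((real t + 1) * (real t + real d + real j))" for j
  have d0: "real d > 0" using d1 by simp
  \<comment> \<open>Expresses the coefficients for degree \<open>t\<close> through those for
    \<open>t + 1\<close>, so that both sums have terms proportional to \<open>T j\<close>.\<close>
  have shift: "jacobi_coeff d t j * ((real t + 1) * (real t + real d + real j))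
     = jacobi_coeff d (Suc t) j * ((real t + 1 - real j) * (real t + real d))" for j
  proof (induction j)
    case (Suc j)
    define c where "c = (real j + 1) * (2 * real j + real d + 2)"
    have "c > 0" unfolding c_def by (intro mult_pos_pos) linarith+
    have e1: "c * jacobi_coeff d t (Suc j)
        = (real j - real t) * (real j + real t + real d) * jacobi_coeff d t j"
      using jacobi_coeff_Suc[of j d t] by (simp add: c_def algebra_simps)
    have e2: "c * jacobi_coeff d (Suc t) (Suc j)
        = (real j - real t - 1) * (real j + real t + 1 + real d) * jacobi_coeff d (Suc t) j"
      using jacobi_coeff_Suc[of j d "Suc t"] by (simp add: c_def algebra_simps)
    have "c * (jacobi_coeff d t (Suc j) * ((real t + 1) * (real t + real d + real (Suc j))))
        = c * (jacobi_coeff d (Suc t) (Suc j) * ((real t + 1 - real (Suc j)) * (real t + real d)))"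
      using e1 e2 Suc.IH unfolding of_nat_Suc by algebra
    with \<open>c > 0\<close> show ?case by simp
  qed simp
  have T_Suc: "(real j + 1) * (2 * real j + real d + 2) * (real j + real d) * T (Suc j)
     = (real j - real t - 1) * (real j + real t + 1 + real d) * (2 * real j + real d) * T j" for j
  proof -
    have "(real j + 1) * (2 * real j + real d + 2) * jacobi_coeff d (Suc t) (Suc j)
        = (real j - real t - 1) * (real j + real t + 1 + real d) * jacobi_coeff d (Suc t) j"
      using jacobi_coeff_Suc[of j d "Suc t"] by (simp add: algebra_simps)
    with L_monom_Suc[of j] show ?thesis unfolding T_def by algebra
  qed
  \<comment> \<open>After clearing denominators every term is a multiple of \<open>T j\<close>,
    which leaves a polynomial identity in \<open>d\<close>, \<open>t\<close> and
    \<open>j\<close>.\<close>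
  have tele: "(real d + 2 * real t + 2) * (real d + real t) * T j
      - (real d + 2 * real t) * (real t + 1) * (jacobi_coeff d t j * L (monom 1 j)) = G (Suc j) - G j" for j
  proof -
    have nz: "real t + 1 \<noteq> 0" "real t + real d + real j \<noteq> 0" "real t + real d + real j + 1 \<noteq> 0"
      using d0 by linarith+
    have G: "G i * ((real t + 1) * (real t + real d + real i))
       = - (real d + 2 * real t + 1) * real i * (2 * real i + real d) * (real i + real d - 1) * T i" for i
    proof -
      have "real t + 1 \<noteq> 0" "real t + real d + real i \<noteq> 0"
        using d0 by linarith+
      then show ?thesis by (simp add: G_def)
    qed
    have "(G (Suc j) * (real t + 1)) * (real t + real d + real j + 1)
         = (- (real d + 2 * real t + 1) * (real j - real t - 1) * (2 * real j + real d) * T j)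
            * (real t + real d + real j + 1)"
      using G[of "Suc j"] T_Suc[of j] unfolding of_nat_Suc by algebra
    then have G1: "G (Suc j) * (real t + 1)
        = - (real d + 2 * real t + 1) * (real j - real t - 1) * (2 * real j + real d) * T j"
      by (rule nz(3)[THEN mult_right_cancel, THEN iffD1])
    note G0 = G[of j]
    have S0: "jacobi_coeff d t j * L (monom 1 j) * ((real t + 1) * (real t + real d + real j))
        = T j * ((real t + 1 - real j) * (real t + real d))"
      using shift[of j] unfolding T_def by algebra
    have "((real d + 2 * real t + 2) * (real d + real t) * T j
      - (real d + 2 * real t) * (real t + 1) * (jacobi_coeff d t j * L (monom 1 j)))
          * ((real t + 1) * (real t + real d + real j))
      = (G (Suc j) - G j) * ((real t + 1) * (real t + real d + real j))"
      using G1 G0 S0 by algebra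
    with nz show ?thesis by simp
  qed
  \<comment> \<open>Both sums run to \<open>Suc t\<close>; the extra coefficient for degree
    \<open>t\<close> is zero.\<close>
  have "(real d + 2 * real t + 2) * (real d + real t) * (\<Sum>j\<le>Suc t. T j)
      - (real d + 2 * real t) * (real t + 1) * (\<Sum>j\<le>Suc t. jacobi_coeff d t j * L (monom 1 j))
      = (\<Sum>j\<le>Suc t. G (Suc j) - G j)"
    by (simp only: sum_distrib_left sum_subtractf[symmetric] tele)
  also have "\<dots> = G (Suc (Suc t)) - G 0"
    using sum_lessThan_telescope[of G "Suc (Suc t)"] by (simp only: lessThan_Suc_atMost)
  also have "\<dots> = 0"
    by (simp add: G_def T_def jacobi_coeff_eq_0)
  finally show ?thesis
    by (simp add: L_jacobi_poly T_def jacobi_coeff_eq_0)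
qed

lemma L_jacobi_poly_eq: "L (jacobi_poly d t) * ((real d + 2 * real t) * real (d + t choose t)) = real d + real t"
proof (induction t)
  case 0
  have "jacobi_poly d 0 = 1"
    by (simp add: jacobi_poly_def)
  then show ?case by (simp add: L_1)
next
  case (Suc t)
  let ?C = "real (d + t choose t)" and ?S = "L (jacobi_poly d t)" and ?S' = "L (jacobi_poly d (Suc t))"
  have C: "(real t + 1) * real (d + Suc t choose Suc t) = (real d + real t + 1) * ?C"
    using Suc_times_binomial_eq[of "d + t" t]
    by (simp add: algebra_simps flip: of_nat_mult of_nat_add of_nat_Suc)
  have "(?S' * ((real d + 2 * real (Suc t)) * real (d + Suc t choose Suc t))) * ((real d + real t) * (real t + 1))
      = (real d + real (Suc t)) * ((real d + real t) * (real t + 1))"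
    using C Suc.IH L_jacobi_poly_Suc[of t] unfolding of_nat_Suc by algebra
  moreover have "(real d + real t) * (real t + 1) \<noteq> 0"
    using d1 by auto
  ultimately show ?case by simp
qed

text \<open>Absorption gives \<open>(d + t) dimPi d t = (d + 2 t) (d + t choose t)\<close>. The
  bound on \<open>t\<close> matters: truncated subtraction makes \<open>dimPi d 0\<close> equal to
  \<open>2\<close>.\<close>

lemma L_jacobi_poly_dimPi:
  assumes "t \<ge> 1"
  shows "L (jacobi_poly d t) * real (dimPi d t) = 1"
proof -
  obtain n where t: "t = Suc n" using assms by (cases t) auto
  have "(real d + real t) * real (d + t - 1 choose (t - 1)) = real t * real (d + t choose t)"
    using Suc_times_binomial_eq[of "d + n" n]
    by (simp add: t algebra_simps flip: of_nat_mult of_nat_add of_nat_Suc)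
  then have "(real d + real t) * real (dimPi d t) = (real d + 2 * real t) * real (d + t choose t)"
    by (simp add: dimPi_def algebra_simps)
  then have "(real d + real t) * (L (jacobi_poly d t) * real (dimPi d t)) = (real d + real t) * 1"
    using L_jacobi_poly_eq[of t] by (simp add: algebra_simps)
  then show ?thesis
    using assms by (subst (asm) mult_cancel_left) auto
qed

end

section \<open>Zonal moments on the sphere\<close>

lemma usphere_in_sets_hausdorff: "usphere \<in> sets (hausdorff_measure s)"
  by (rule closed_in_sets_hausdorff) simp

lemma set_integrable_hausdorff_usphere:
  fixes g :: "real^'n \<Rightarrow> real"
  assumes fin: "emeasure (hausdorff_measure s) (usphere :: (real^'n) set) < \<infinity>"
    and g: "continuous_on UNIV g"
  shows "set_integrable (hausdorff_measure s) usphere g"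
proof -
  have "compact (g ` usphere)"
    by (intro compact_continuous_image continuous_on_subset[OF g]) auto
  then obtain B where "\<forall>y\<in>g ` usphere. norm y \<le> B"
    using compact_imp_bounded[of "g ` usphere"] unfolding bounded_iff by blast
  then have "\<And>x. x \<in> usphere \<Longrightarrow> norm (g x) \<le> B"
    by blast
  then show ?thesis
    unfolding set_integrable_def
    using borel_measurable_hausdorff[OF borel_measurable_continuous_onI[OF g]] fin
    by (intro integrableI_bounded_set_indicator[where B = B] usphere_in_sets_hausdorff) auto
qed

text \<open>A change of variables: an orthogonal map is a surjective isometry that preserves the
  sphere.\<close>

lemma hausdorff_usphere_integral_orthogonal:
  fixes g :: "real^'n \<Rightarrow> real" and f :: "real^'n \<Rightarrow> real^'n"
  assumes f: "orthogonal_transformation f" and g: "continuous_on UNIV g"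
  shows "(LINT x:usphere|hausdorff_measure s. g (f x)) = (LINT x:usphere|hausdorff_measure s. g x)"
proof -
  let ?H = "hausdorff_measure s :: (real^'n) measure"
  have surj: "surj f"
    by (rule orthogonal_transformation_surj[OF f])
  have nf: "norm (f x) = norm x" for x
    by (rule orthogonal_transformation_norm[OF f])
  have iso: "dist (f x) (f y) = dist x y" for x y
    using nf[of "x - y"] orthogonal_transformation_linear[OF f] by (simp add: dist_norm linear_diff)
  have ind: "indicator usphere (f x) = (indicator usphere x :: real)" for x
    by (simp add: indicator_def nf)
  have meas: "(\<lambda>x. indicator usphere x *\<^sub>R g x) \<in> borel_measurable ?H"
    using borel_measurable_hausdorff[OF borel_measurable_continuous_onI[OF g], of s]
      usphere_in_sets_hausdorff[of s]
    by (intro borel_measurable_scaleR borel_measurable_indicator) auto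
  have "(LINT x:usphere|?H. g x) = (\<integral>x. indicator usphere x *\<^sub>R g x \<partial>distr ?H ?H f)"
    by (simp add: set_lebesgue_integral_def distr_hausdorff_measure_isometry(2)[of f, OF iso surj])
  also have "\<dots> = (\<integral>x. indicator usphere (f x) *\<^sub>R g (f x) \<partial>?H)"
    by (rule integral_distr[OF distr_hausdorff_measure_isometry(1)[of f, OF iso surj] meas])
  finally show ?thesis
    by (simp add: set_lebesgue_integral_def ind)
qed

locale finite_sphere =
  fixes s :: real and n :: "'n::finite itself"
  assumes fin: "emeasure (hausdorff_measure s) (usphere :: (real^'n) set) < \<infinity>"
begin

abbreviation "H \<equiv> hausdorff_measure s :: (real^'n) measure"

definition sphere_int :: "(real^'n \<Rightarrow> real) \<Rightarrow> real" where
  "sphere_int g = (LINT x:usphere|H. g x)"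

lemma sphere_int_cong: "(\<And>x. norm x = 1 \<Longrightarrow> f x = g x) \<Longrightarrow> sphere_int f = sphere_int g"
  unfolding sphere_int_def using usphere_in_sets_hausdorff by (intro set_lebesgue_integral_cong) auto

lemma sphere_int_add:
  "continuous_on UNIV f \<Longrightarrow> continuous_on UNIV g \<Longrightarrow>
     sphere_int (\<lambda>x. f x + g x) = sphere_int f + sphere_int g"
  unfolding sphere_int_def by (intro set_integral_add set_integrable_hausdorff_usphere fin)

lemma sphere_int_cmult: "sphere_int (\<lambda>x. c * f x) = c * sphere_int f"
  unfolding sphere_int_def by simp

lemma sphere_int_sum:
  assumes "\<And>i. i \<in> I \<Longrightarrow> continuous_on UNIV (f i)"
  shows "sphere_int (\<lambda>x. \<Sum>i\<in>I. f i x) = (\<Sum>i\<in>I. sphere_int (f i))"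
  using assms
proof (induction I rule: infinite_finite_induct)
  case (insert i I)
  then show ?case by (simp add: sphere_int_add continuous_on_sum)
qed (auto simp: sphere_int_def set_lebesgue_integral_def)

text \<open>The direction \<open>a\<close> ranges over all vectors, so that homogeneity in
  \<open>a\<close> can be combined with dependence on \<open>norm a\<close> alone.\<close>

definition moment :: "nat \<Rightarrow> real^'n \<Rightarrow> real" where
  "moment i a = sphere_int (\<lambda>x. (x \<bullet> a) ^ i)"

lemma moment_cong_norm:
  assumes "norm a = norm b"
  shows "moment i a = moment i b"
proof -
  obtain f where f: "orthogonal_transformation f" "f a = b"
    using orthogonal_transformation_exists[OF assms] by blast
  have "moment i b = sphere_int (\<lambda>x. (f x \<bullet> b) ^ i)"
    unfolding moment_def sphere_int_def
    by (intro hausdorff_usphere_integral_orthogonal[OF f(1), symmetric] continuous_intros)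
  also have "\<dots> = moment i a"
    unfolding moment_def using f by (auto simp: orthogonal_transformation_def)
  finally show ?thesis ..
qed

lemma moment_scaleR: "moment i (c *\<^sub>R a) = c ^ i * moment i a"
  by (simp add: moment_def power_mult_distrib sphere_int_cmult)

lemma moment_odd: "odd i \<Longrightarrow> moment i a = 0"
  using moment_cong_norm[of "- a" a i] moment_scaleR[of i "-1" a] by simp

text \<open>Both sides of \<open>moment i (e + c b) = (1 + c\<^sup>2) ^ (i/2) moment i e\<close> are polynomials in \<open>c\<close>;
  compare the coefficients of \<open>c\<^sup>2\<close>.\<close>
lemma moment_second_variation:
  assumes e: "norm e = 1" and b: "norm b = 1" and eb: "e \<bullet> b = 0"
  shows "real (2 * k + 1) * sphere_int (\<lambda>x. (x \<bullet> b)\<^sup>2 * (x \<bullet> e) ^ (2 * k)) = moment (2 * k + 2) e"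
proof -
  let ?m = "2 * k + 2"
  \<comment> \<open>Mixed moments in the two orthogonal directions; they appear in the binomial
    expansion of the moment along \<open>r *\<^sub>R b + e\<close>.\<close>
  define c where "c j = sphere_int (\<lambda>x. (x \<bullet> b) ^ j * (x \<bullet> e) ^ (?m - j))" for j
  define P where "P = (\<Sum>j\<le>?m. monom (real (?m choose j) * c j) j)"
  define Q where "Q = smult (moment ?m e) ([:1, 0, 1:] ^ (k + 1))"
  have "P = Q"
  proof (rule poly_ext)
    fix r :: real
    have "moment ?m (r *\<^sub>R b + e) = sphere_int (\<lambda>x. (r * (x \<bullet> b) + x \<bullet> e) ^ ?m)"
      by (simp add: moment_def inner_add_right)
    also have "\<dots> = sphere_int (\<lambda>x. \<Sum>j\<le>?m. (real (?m choose j) * r ^ j) * ((x \<bullet> b) ^ j * (x \<bullet> e) ^ (?m - j)))"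
      by (subst binomial_ring) (simp add: power_mult_distrib mult_ac)
    also have "\<dots> = (\<Sum>j\<le>?m. (real (?m choose j) * r ^ j) * c j)"
      by (subst sphere_int_sum) (auto intro!: continuous_intros simp: sphere_int_cmult c_def)
    also have "\<dots> = poly P r"
      by (simp add: P_def poly_sum poly_monom mult_ac)
    finally have 1: "moment ?m (r *\<^sub>R b + e) = poly P r" .
    have "(norm (r *\<^sub>R b + e))\<^sup>2 = 1 + r\<^sup>2"
      using e b eb unfolding power2_norm_eq_inner
      by (simp add: inner_add_left inner_add_right inner_commute norm_eq_1 power2_eq_square)
    then have "norm (r *\<^sub>R b + e) = norm (sqrt (1 + r\<^sup>2) *\<^sub>R e)"
      using e by (simp add: real_sqrt_unique)
    then have "moment ?m (r *\<^sub>R b + e) = sqrt (1 + r\<^sup>2) ^ ?m * moment ?m e"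
      by (metis moment_cong_norm moment_scaleR)
    also have "sqrt (1 + r\<^sup>2) ^ ?m = (sqrt (1 + r\<^sup>2) ^ 2) ^ (k + 1)"
      by (subst power_mult[symmetric]) simp
    also have "\<dots> = (1 + r\<^sup>2) ^ (k + 1)"
      by simp
    also have "\<dots> = poly ([:1, 0, 1:] ^ (k + 1)) r"
      unfolding poly_power by (simp add: power2_eq_square)
    finally show "poly P r = poly Q r"
      unfolding 1 Q_def by simp
  qed
  moreover have "coeff P 2 = real (?m choose 2) * c 2"
    unfolding P_def coeff_sum coeff_monom by (subst sum.delta) auto
  moreover have "coeff Q 2 = moment ?m e * real (k + 1)"
  proof -
    \<comment> \<open>The constant coefficient is carried along because multiplying by
      \<open>[:1, 0, 1:]\<close> adds it to the coefficient at index \<open>2\<close>.\<close>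
    have "coeff ([:1, 0, 1:] ^ j :: real poly) 0 = 1 \<and> coeff ([:1, 0, 1:] ^ j :: real poly) 2 = real j" for j
      by (induction j) (auto simp: coeff_pCons numeral_2_eq_2)
    then show ?thesis by (simp add: Q_def del: power_Suc)
  qed
  moreover have "real (?m choose 2) = real (k + 1) * real (2 * k + 1)"
    by (simp add: choose_two field_simps)
  ultimately have "real (k + 1) * (real (2 * k + 1) * c 2) = real (k + 1) * moment ?m e"
    by (simp add: mult_ac)
  then show ?thesis
    by (simp add: c_def del: of_nat_Suc)
qed

text \<open>On the sphere the squared coordinates sum to \<open>1\<close>. Inserting this sum into
  the moment of order \<open>i\<close> gives one term along \<open>e\<close>, and each of the other
  \<open>CARD('n) - 1\<close> directions is given by \<open>moment_second_variation\<close>.\<close>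

lemma moment_recursion:
  assumes e: "norm e = 1"
  shows "(real i + 1) * moment i e = (real CARD('n) + real i) * moment (i + 2) e"
proof (cases "odd i")
  case False
  then obtain k where i: "i = 2 * k" by (auto elim: evenE)
  \<comment> \<open>By rotation invariance a coordinate axis may replace \<open>e\<close>, and the
    remaining axes then complete it to an orthonormal basis.\<close>
  obtain i0 :: 'n where True by simp
  define a where "a = axis i0 (1::real)"
  have a: "norm a = 1" by (simp add: a_def)
  have cont: "continuous_on UNIV (\<lambda>x. (x \<bullet> b)\<^sup>2 * (x \<bullet> a) ^ i)" for b :: "real^'n"
    by (intro continuous_intros)
  have one: "(real i + 1) * sphere_int (\<lambda>x. (x \<bullet> axis j 1)\<^sup>2 * (x \<bullet> a) ^ i) = moment (i + 2) a"
    if "j \<noteq> i0" for j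
    using moment_second_variation[of a "axis j 1" k] that a
    by (simp add: i a_def inner_axis_axis add.commute)
  have "moment i a = sphere_int (\<lambda>x. \<Sum>j\<in>UNIV. (x \<bullet> axis j 1)\<^sup>2 * (x \<bullet> a) ^ i)"
    unfolding moment_def
  proof (rule sphere_int_cong)
    fix x :: "real^'n" assume "norm x = 1"
    then have "(\<Sum>j\<in>UNIV. (x $ j)\<^sup>2) = 1"
      by (simp add: norm_eq_1 inner_vec_def power2_eq_square)
    then show "(x \<bullet> a) ^ i = (\<Sum>j\<in>UNIV. (x \<bullet> axis j 1)\<^sup>2 * (x \<bullet> a) ^ i)"
      by (simp add: inner_axis flip: sum_distrib_right)
  qed
  also have "\<dots> = (\<Sum>j\<in>UNIV. sphere_int (\<lambda>x. (x \<bullet> axis j 1)\<^sup>2 * (x \<bullet> a) ^ i))"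
    by (intro sphere_int_sum cont)
  also have "\<dots> = sphere_int (\<lambda>x. (x \<bullet> a)\<^sup>2 * (x \<bullet> a) ^ i)
      + (\<Sum>j\<in>UNIV - {i0}. sphere_int (\<lambda>x. (x \<bullet> axis j 1)\<^sup>2 * (x \<bullet> a) ^ i))"
    by (subst sum.remove[of _ i0]) (auto simp: a_def)
  finally have "(real i + 1) * moment i a = (real i + 1) * moment (i + 2) a
      + (\<Sum>j\<in>UNIV - {i0}. (real i + 1) * sphere_int (\<lambda>x. (x \<bullet> axis j 1)\<^sup>2 * (x \<bullet> a) ^ i))"
    by (simp add: distrib_left sum_distrib_left moment_def power_add mult.commute mult.left_commute
        power2_eq_square)
  also have "\<dots> = (real i + 1) * moment (i + 2) a + real (CARD('n) - 1) * moment (i + 2) a"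
    by (simp add: one card_Diff_singleton)
  also have "\<dots> = (real CARD('n) + real i) * moment (i + 2) a"
    by (simp add: of_nat_diff algebra_simps)
  finally show ?thesis
    using moment_cong_norm[of a e] a e by simp
qed (simp add: moment_odd)

section \<open>Integration by parts for zonal functions\<close>

lemma continuous_on_poly_inner: "continuous_on UNIV (\<lambda>x::real^'n. poly p (x \<bullet> e))"
  by (intro continuous_intros)

text \<open>For the zonal density \<open>(1 - u^2)^(d/2 - 1)\<close> the integrand is the derivative
  of \<open>(1 - u^2)^(d/2) g\<close>. Without that density, the identity follows by linearity from
  \<open>moment_recursion\<close> on monomials.\<close>

lemma zonal_ibp:
  assumes e: "norm e = 1" and d: "CARD('n) = d + 1"
  shows "sphere_int (\<lambda>x. poly ([:1, 0, -1:] * pderiv g - smult (real d) ([:0, 1:] * g)) (x \<bullet> e)) = 0"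
proof -
  define \<Phi> where "\<Phi> g = [:1, 0, -1:] * pderiv g - smult (real d) ([:0, 1:] * g)" for g :: "real poly"
  have \<Phi>_add: "\<Phi> (p + q) = \<Phi> p + \<Phi> q" for p q
    by (rule poly_ext) (simp add: \<Phi>_def pderiv_add algebra_simps)
  have \<Phi>_sum: "\<Phi> (\<Sum>i\<in>I. f i) = (\<Sum>i\<in>I. \<Phi> (f i))" if "finite I" for f and I :: "nat set"
    using that by (induction I) (auto simp: \<Phi>_add, simp add: \<Phi>_def)
  have mono: "sphere_int (\<lambda>x. poly (\<Phi> (monom c i)) (x \<bullet> e)) = 0" for c i
  proof (cases i)
    case 0
    have "poly (\<Phi> (monom c i)) u = (- c * real d) * u ^ 1" for u
      by (simp add: \<Phi>_def 0 pderiv_monom poly_monom)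
    then have "sphere_int (\<lambda>x. poly (\<Phi> (monom c i)) (x \<bullet> e)) = (- c * real d) * moment 1 e"
      unfolding moment_def by (simp only: sphere_int_cmult)
    then show ?thesis by (simp add: moment_odd)
  next
    case (Suc k)
    have "poly (\<Phi> (monom c i)) u = (c * (real k + 1)) * u ^ k + (- c * (real k + 1 + real d)) * u ^ (k + 2)" for u
      by (simp add: \<Phi>_def Suc pderiv_monom poly_monom algebra_simps)
    then have "sphere_int (\<lambda>x. poly (\<Phi> (monom c i)) (x \<bullet> e))
        = sphere_int (\<lambda>x. (c * (real k + 1)) * (x \<bullet> e) ^ k + (- c * (real k + 1 + real d)) * (x \<bullet> e) ^ (k + 2))"
      by simp
    also have "\<dots> = (c * (real k + 1)) * moment k e + (- c * (real k + 1 + real d)) * moment (k + 2) e"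
      unfolding moment_def
      by (subst sphere_int_add) (intro continuous_intros, intro continuous_intros, simp only: sphere_int_cmult)
    also have "\<dots> = c * ((real k + 1) * moment k e - (real CARD('n) + real k) * moment (k + 2) e)"
      by (simp add: d algebra_simps)
    finally show ?thesis
      using moment_recursion[OF e, of k] by simp
  qed
  have "g = (\<Sum>i\<le>degree g. monom (coeff g i) i)"
    by (rule poly_as_sum_of_monoms[symmetric])
  then have "\<Phi> g = (\<Sum>i\<le>degree g. \<Phi> (monom (coeff g i) i))"
    by (metis \<Phi>_sum finite_atMost)
  then have "sphere_int (\<lambda>x. poly (\<Phi> g) (x \<bullet> e))
      = (\<Sum>i\<le>degree g. sphere_int (\<lambda>x. poly (\<Phi> (monom (coeff g i) i)) (x \<bullet> e)))"
    by (simp add: poly_sum sphere_int_sum continuous_on_poly_inner)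
  then show ?thesis
    unfolding \<Phi>_def[symmetric] by (simp add: mono)
qed

lemma zonal_functional_sphere:
  assumes e: "norm e = 1" and d: "CARD('n) = d + 1" and "d \<ge> 1" and pos: "measure H usphere \<noteq> 0"
  shows "zonal_functional d (\<lambda>p. sphere_int (\<lambda>x. poly p (1 - x \<bullet> e)) / measure H usphere)"
proof
  fix p q g :: "real poly" and c :: real
  have cont: "continuous_on UNIV (\<lambda>x. poly p (1 - x \<bullet> e))" for p
    by (intro continuous_intros)
  show "sphere_int (\<lambda>x. poly (p + q) (1 - x \<bullet> e)) / measure H usphere
      = sphere_int (\<lambda>x. poly p (1 - x \<bullet> e)) / measure H usphere
        + sphere_int (\<lambda>x. poly q (1 - x \<bullet> e)) / measure H usphere"
    by (simp add: sphere_int_add cont add_divide_distrib)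
  show "sphere_int (\<lambda>x. poly (smult c p) (1 - x \<bullet> e)) / measure H usphere
      = c * (sphere_int (\<lambda>x. poly p (1 - x \<bullet> e)) / measure H usphere)"
    by (simp add: sphere_int_cmult)
  show "sphere_int (\<lambda>x. poly 1 (1 - x \<bullet> e)) / measure H usphere = 1"
    using pos usphere_in_sets_hausdorff by (simp add: sphere_int_def set_lebesgue_integral_def)
  \<comment> \<open>The substitution \<open>u = 1 - v\<close>; the chain rule accounts for the
    factor \<open>- 1\<close>.\<close>
  let ?h = "g \<circ>\<^sub>p [:1, -1:]"
  have "poly ([:0, 2, -1:] * pderiv g + smult (real d) ([:1, -1:] * g)) (1 - u)
      = - 1 * poly ([:1, 0, -1:] * pderiv ?h - smult (real d) ([:0, 1:] * ?h)) u" for u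
    by (simp add: pderiv_pcompose poly_pcompose pderiv_pCons algebra_simps)
  then have "sphere_int (\<lambda>x. poly ([:0, 2, -1:] * pderiv g + smult (real d) ([:1, -1:] * g)) (1 - x \<bullet> e))
     = - 1 * sphere_int (\<lambda>x. poly ([:1, 0, -1:] * pderiv ?h - smult (real d) ([:0, 1:] * ?h)) (x \<bullet> e))"
    by (simp only: sphere_int_cmult)
  then show "sphere_int (\<lambda>x. poly ([:0, 2, -1:] * pderiv g + smult (real d) ([:1, -1:] * g)) (1 - x \<bullet> e))
      / measure H usphere = 0"
    by (simp only: zonal_ibp[OF e d])
qed fact

end

section \<open>Zonal polynomials as elements of the polynomial space\<close>

text \<open>Needed because a \<open>sum\<close> over an infinite index set is \<open>0\<close> by
  convention.\<close>

lemma finite_exponents: "finite {\<alpha> :: 'n::finite \<Rightarrow> nat. sum \<alpha> UNIV \<le> t}"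
proof (rule finite_subset)
  show "{\<alpha> :: 'n \<Rightarrow> nat. sum \<alpha> UNIV \<le> t} \<subseteq> UNIV \<rightarrow> {..t}"
  proof safe
    fix \<alpha> :: "'n \<Rightarrow> nat" and i assume "sum \<alpha> UNIV \<le> t"
    then show "\<alpha> i \<le> t"
      using member_le_sum[of i UNIV \<alpha>] by simp
  qed
  show "finite ((UNIV :: 'n set) \<rightarrow> {..t})"
    using finite_PiE[of "UNIV :: 'n set" "\<lambda>_. {..t}"] by (simp add: PiE_UNIV_domain)
qed

lemma poly_space_monomial:
  assumes "sum \<alpha> UNIV \<le> t"
  shows "(\<lambda>x :: real^'n. \<Prod>i\<in>UNIV. (x $ i) ^ \<alpha> i) \<in> poly_space t"
  unfolding poly_space_def
proof (intro CollectI exI[of _ "\<lambda>\<beta>. if \<beta> = \<alpha> then 1 else 0"] ext)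
  show "(\<Prod>i\<in>UNIV. (x $ i) ^ \<alpha> i)
      = (\<Sum>\<beta>\<in>{\<beta>. sum \<beta> UNIV \<le> t}. (if \<beta> = \<alpha> then 1 else 0) * (\<Prod>i\<in>UNIV. (x $ i) ^ \<beta> i))"
    for x :: "real^'n"
    using assms finite_exponents[where 'n = 'n, of t]
    by (simp add: if_distrib[of "\<lambda>c. c * _"] cong: if_cong)
qed

lemma poly_space_add:
  assumes "f \<in> poly_space t" "g \<in> poly_space t"
  shows "(\<lambda>x. f x + g x) \<in> poly_space t"
proof -
  from assms obtain c c' where
    "f = (\<lambda>x. \<Sum>\<alpha>\<in>{\<alpha>. sum \<alpha> UNIV \<le> t}. c \<alpha> * (\<Prod>i\<in>UNIV. (x $ i) ^ \<alpha> i))"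
    "g = (\<lambda>x. \<Sum>\<alpha>\<in>{\<alpha>. sum \<alpha> UNIV \<le> t}. c' \<alpha> * (\<Prod>i\<in>UNIV. (x $ i) ^ \<alpha> i))"
    unfolding poly_space_def by auto
  then show ?thesis
    unfolding poly_space_def
    by (intro CollectI exI[of _ "\<lambda>\<alpha>. c \<alpha> + c' \<alpha>"]) (simp add: sum.distrib distrib_right)
qed

lemma poly_space_cmult:
  assumes "f \<in> poly_space t"
  shows "(\<lambda>x. a * f x) \<in> poly_space t"
proof -
  from assms obtain c where
    "f = (\<lambda>x. \<Sum>\<alpha>\<in>{\<alpha>. sum \<alpha> UNIV \<le> t}. c \<alpha> * (\<Prod>i\<in>UNIV. (x $ i) ^ \<alpha> i))"
    unfolding poly_space_def by auto
  then show ?thesis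
    unfolding poly_space_def
    by (intro CollectI exI[of _ "\<lambda>\<alpha>. a * c \<alpha>"]) (simp add: sum_distrib_left mult.assoc)
qed

lemma poly_space_const: "(\<lambda>_. a) \<in> poly_space t"
  using poly_space_cmult[OF poly_space_monomial[of "\<lambda>_. 0"], of t a] by simp

lemma poly_space_sum:
  "(\<And>i. i \<in> I \<Longrightarrow> f i \<in> poly_space t) \<Longrightarrow> (\<lambda>x. \<Sum>i\<in>I. f i x) \<in> poly_space t"
  by (induction I rule: infinite_finite_induct) (auto intro: poly_space_const poly_space_add)

lemma poly_space_mono:
  assumes "f \<in> poly_space t" "t \<le> u"
  shows "f \<in> poly_space u"
proof -
  from assms obtain c where
    "f = (\<lambda>x. \<Sum>\<alpha>\<in>{\<alpha>. sum \<alpha> UNIV \<le> t}. c \<alpha> * (\<Prod>i\<in>UNIV. (x $ i) ^ \<alpha> i))"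
    unfolding poly_space_def by auto
  also have "\<dots> \<in> poly_space u"
    using assms by (intro poly_space_sum poly_space_cmult poly_space_monomial) auto
  finally show ?thesis .
qed

lemma poly_space_mult_coord:
  fixes f :: "real^'n \<Rightarrow> real"
  assumes "f \<in> poly_space t"
  shows "(\<lambda>x. x $ i * f x) \<in> poly_space (Suc t)"
proof -
  from assms obtain c where
    f: "f = (\<lambda>x. \<Sum>\<alpha>\<in>{\<alpha>. sum \<alpha> UNIV \<le> t}. c \<alpha> * (\<Prod>j\<in>UNIV. (x $ j) ^ \<alpha> j))"
    unfolding poly_space_def by auto
  have upd: "x $ i * (\<Prod>j\<in>UNIV. (x $ j) ^ \<alpha> j) = (\<Prod>j\<in>UNIV. (x $ j) ^ (\<alpha>(i := Suc (\<alpha> i))) j)"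
    for x :: "real^'n" and \<alpha>
    by (simp add: prod.remove[of UNIV i])
  have deg: "sum (\<alpha>(i := Suc (\<alpha> i))) UNIV = Suc (sum \<alpha> UNIV)" for \<alpha>
    by (simp add: sum.remove[of UNIV i])
  have "(\<lambda>x. x $ i * f x)
      = (\<lambda>x. \<Sum>\<alpha>\<in>{\<alpha>. sum \<alpha> UNIV \<le> t}. c \<alpha> * (\<Prod>j\<in>UNIV. (x $ j) ^ (\<alpha>(i := Suc (\<alpha> i))) j))"
    unfolding f sum_distrib_left upd[symmetric] by (simp add: mult.left_commute)
  also have "\<dots> \<in> poly_space (Suc t)"
    by (intro poly_space_sum poly_space_cmult poly_space_monomial) (simp add: deg del: fun_upd_apply)
  finally show ?thesis .
qed

text \<open>One more factor is expanded in coordinates, and each coordinate raises the degree by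
  one.\<close>

lemma poly_space_zonal_power: "(\<lambda>x :: real^'n. (1 - x \<bullet> e) ^ j) \<in> poly_space j"
proof (induction j)
  case (Suc j)
  have "(1 - x \<bullet> e) ^ Suc j = (1 - x \<bullet> e) ^ j + (\<Sum>i\<in>UNIV. - (e $ i) * (x $ i * (1 - x \<bullet> e) ^ j))"
    for x :: "real^'n"
    by (simp add: inner_vec_def sum_distrib_right algebra_simps sum_negf)
  moreover have "(\<lambda>x :: real^'n. (1 - x \<bullet> e) ^ j + (\<Sum>i\<in>UNIV. - (e $ i) * (x $ i * (1 - x \<bullet> e) ^ j)))
      \<in> poly_space (Suc j)"
    using Suc
    by (intro poly_space_add poly_space_sum poly_space_cmult poly_space_mult_coord)
       (auto intro: poly_space_mono)
  ultimately show ?case by simp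
qed (simp add: poly_space_const)

lemma poly_space_jacobi: "(\<lambda>x. poly (jacobi_poly d t) (1 - x \<bullet> e)) \<in> poly_space t"
  unfolding poly_jacobi_poly
  by (intro poly_space_sum poly_space_cmult) (auto intro: poly_space_mono poly_space_zonal_power)

section \<open>The lower bound\<close>

text \<open>\<open>f\<close> is bounded on the compact sphere, so a multiple of \<open>w\<close>
  dominates. The comparison of Bochner integrals in the final estimate requires this
  integrability.\<close>

lemma set_integrable_continuous_square_mult:
  fixes f w :: "real^'n \<Rightarrow> real"
  assumes X: "X \<subseteq> usphere" and w: "set_integrable (hausdorff_measure s) X w"
    and f: "continuous_on UNIV f"
  shows "set_integrable (hausdorff_measure s) X (\<lambda>x. \<bar>f x\<bar>\<^sup>2 * w x)"
proof -
  let ?H = "hausdorff_measure s :: (real^'n) measure"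
  let ?w = "\<lambda>x. indicator X x *\<^sub>R w x"
  have "compact (f ` usphere)"
    by (intro compact_continuous_image continuous_on_subset[OF f]) auto
  then obtain B where "\<forall>y\<in>f ` usphere. norm y \<le> B"
    using compact_imp_bounded[of "f ` usphere"] unfolding bounded_iff by blast
  then have B: "\<bar>f x\<bar> \<le> B" if "x \<in> X" for x
    using that X by auto
  have int: "integrable ?H ?w"
    using w by (simp add: set_integrable_def)
  have "integrable ?H (\<lambda>x. B\<^sup>2 * ?w x)"
    using int by (rule integrable_mult_right)
  then have "integrable ?H (\<lambda>x. (f x)\<^sup>2 * ?w x)"
  proof (rule Bochner_Integration.integrable_bound)
    show "(\<lambda>x. (f x)\<^sup>2 * ?w x) \<in> borel_measurable ?H"
      using borel_measurable_hausdorff[OF borel_measurable_continuous_onI[OF f]] int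
      by (intro borel_measurable_times borel_measurable_power) auto
    have "(f x)\<^sup>2 * \<bar>?w x\<bar> \<le> B\<^sup>2 * \<bar>?w x\<bar>" for x
      using B[of x] power_mono[of "\<bar>f x\<bar>" B 2]
      by (cases "x \<in> X") (auto intro: mult_right_mono)
    then show "AE x in ?H. norm ((f x)\<^sup>2 * ?w x) \<le> norm (B\<^sup>2 * ?w x)"
      by (simp add: abs_mult)
  qed
  then show ?thesis
    by (simp add: set_integrable_def mult_ac)
qed

text \<open>From \<open>cos x = 1 - 2 sin(x/2)^2\<close>; it bounds \<open>1 - x \<bullet> e\<close>
  on a cap by half the squared radius.\<close>

lemma one_minus_half_square_le_cos: "1 - x\<^sup>2 / 2 \<le> cos x" for x :: real
proof -
  have "(sin (x / 2))\<^sup>2 \<le> (x / 2)\<^sup>2"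
    using abs_sin_x_le_abs_x[of "x / 2"] by (simp only: abs_le_square_iff)
  then show ?thesis
    using cos_double_sin[of "x / 2"] by (simp add: power_divide)
qed

theorem theorem6p2:
  fixes X :: "(real^'n) set" and w :: "real^'n \<Rightarrow> real"
    and d t :: nat and s A \<nu> q :: real and xt :: "real^'n"
  defines "H \<equiv> hausdorff_measure s"
  assumes d_def: "CARD('n) = d + 1" and d1: "d \<ge> 1" and t1: "t \<ge> 1"
    and s0: "0 \<le> s" and sd: "s \<le> real d"
    and Xsub: "X \<subseteq> usphere" and Xmeas: "X \<in> sets H"
    and Xpos: "0 < emeasure H X" and Xfin: "emeasure H X < \<infinity>"
    and wnn: "\<forall>x\<in>X. 0 \<le> w x" and wint: "set_integrable H X w"
    and MZ: "\<forall>f\<in>poly_space t.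
        (1 / measure H X) * (\<integral>x\<in>X. \<bar>f x\<bar>\<^sup>2 * w x \<partial>H) \<le> A * sphere_L2sq f"
    and xt: "xt \<in> X" and \<nu>: "0 < \<nu>" "\<nu> < 1" and q: "q > 0"
    and cap_mass: "(\<integral>x\<in>X \<inter> cap xt (sqrt ((1 - \<nu>) * (d + 2) / (t * (t + d)))). w x \<partial>H)
        \<ge> q * sqrt ((1 - \<nu>) * (d + 2) / (t * (t + d))) powr s"
  shows "measure H X \<ge>
     (q * \<nu>\<^sup>2 / A * ((1 - \<nu>) / (1 + d / t) * (d + 2)) powr (s / 2)) * real (dimPi d t) / real t powr s"
proof -
  \<comment> \<open>\<open>Y\<close> is the squared radius of the cap.\<close>
  define Y where "Y = (1 - \<nu>) * (real d + 2) / (real t * (real t + real d))"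
  define C where "C = cap xt (sqrt Y)"
  define m where "m = measure H X"
  have t0: "real t > 0" using t1 by simp
  have Y0: "Y > 0"
    unfolding Y_def using \<nu> t0 by (intro divide_pos_pos mult_pos_pos) auto
  have cap: "q * sqrt Y powr s \<le> (\<integral>x\<in>X \<inter> C. w x \<partial>H)"
    using cap_mass by (simp add: C_def Y_def algebra_simps)
  have m0: "m > 0"
    unfolding m_def measure_def using Xpos Xfin by (simp add: enn2real_positive_iff)
  have "closed C"
  proof -
    have "C = usphere \<inter> {y. cos (sqrt Y) \<le> xt \<bullet> y}"
      by (auto simp: C_def cap_def)
    then show ?thesis by (auto intro!: closed_Int closed_halfspace_ge)
  qed
  then have Cmeas: "C \<in> sets H"
    unfolding H_def by (rule closed_in_sets_hausdorff)
  have nxt: "norm xt = 1" using xt Xsub by auto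

  \<comment> \<open>Stated for general \<open>f\<close> because it serves twice: for the constant
    \<open>1\<close>, which excludes degenerate cases, and for the kernel.\<close>
  have lower: "c\<^sup>2 * (q * sqrt Y powr s) \<le> (\<integral>x\<in>X. \<bar>f x\<bar>\<^sup>2 * w x \<partial>H)"
    if f: "continuous_on UNIV f" and c: "c \<ge> 0" "\<And>x. x \<in> C \<Longrightarrow> c \<le> f x" for f c
  proof -
    have "c\<^sup>2 * (q * sqrt Y powr s) \<le> c\<^sup>2 * (\<integral>x\<in>X \<inter> C. w x \<partial>H)"
      by (intro mult_left_mono cap) auto
    also have "\<dots> = (\<integral>x. indicator (X \<inter> C) x *\<^sub>R (c\<^sup>2 * w x) \<partial>H)"
      by (simp add: set_lebesgue_integral_def flip: integral_mult_right_zero)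
         (simp add: mult.left_commute)
    also have "\<dots> \<le> (\<integral>x. indicator X x *\<^sub>R (\<bar>f x\<bar>\<^sup>2 * w x) \<partial>H)"
    proof (rule integral_mono)
      have "set_integrable H (X \<inter> C) w"
        using wint Xmeas Cmeas by (rule_tac set_integrable_subset) auto
      then show "integrable H (\<lambda>x. indicator (X \<inter> C) x *\<^sub>R (c\<^sup>2 * w x))"
        unfolding set_integrable_def[symmetric] by simp
      show "integrable H (\<lambda>x. indicator X x *\<^sub>R (\<bar>f x\<bar>\<^sup>2 * w x))"
        using set_integrable_continuous_square_mult[OF Xsub wint[unfolded H_def] f]
        unfolding set_integrable_def H_def .
      fix x
      show "indicator (X \<inter> C) x *\<^sub>R (c\<^sup>2 * w x) \<le> indicator X x *\<^sub>R (\<bar>f x\<bar>\<^sup>2 * w x)"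
      proof (cases "x \<in> X \<inter> C")
        case True
        then have "c\<^sup>2 \<le> (f x)\<^sup>2"
          using c by (intro power_mono) auto
        with True wnn show ?thesis by (auto intro: mult_right_mono)
      next
        case False
        with wnn show ?thesis by (cases "x \<in> X") auto
      qed
    qed
    finally show ?thesis
      by (simp add: set_lebesgue_integral_def)
  qed

  have mass0: "0 < q * sqrt Y powr s"
    using q Y0 by simp
  have "0 < (1 / m) * (\<integral>x\<in>X. \<bar>1\<bar>\<^sup>2 * w x \<partial>H)"
    using lower[of "\<lambda>_. 1" 1] mass0 m0 by (intro mult_pos_pos) auto
  also have "\<dots> \<le> A * sphere_L2sq (\<lambda>_::real^'n. 1)"
    unfolding m_def by (rule bspec[OF MZ poly_space_const])
  finally have pos1: "0 < A * sphere_L2sq (\<lambda>_::real^'n. 1)" .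

  let ?S = "hausdorff_measure (real d) :: (real^'n) measure"
  have L2: "sphere_L2sq f = (\<integral>x\<in>usphere. (f x)\<^sup>2 \<partial>?S) / measure ?S usphere" for f :: "real^'n \<Rightarrow> real"
    unfolding sphere_L2sq_def d_def by simp
  have S0: "measure ?S usphere \<noteq> 0"
    using pos1 by (auto simp: L2)
  \<comment> \<open>\<open>measure\<close> returns \<open>0\<close> on sets of infinite measure as
    well, so a nonzero value implies finiteness.\<close>
  then have Sfin: "emeasure ?S usphere < \<infinity>"
    by (metis enn2real_top infinity_ennreal_def less_top measure_def)
  interpret finite_sphere "real d" "TYPE('n)"
    using Sfin by unfold_locales
  interpret Z: zonal_functional d "\<lambda>p. sphere_int (\<lambda>x. poly p (1 - x \<bullet> xt)) / measure ?S usphere"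
    by (rule zonal_functional_sphere[OF nxt d_def d1 S0])

  have "sphere_L2sq (\<lambda>_::real^'n. 1) = 1"
    using S0 usphere_in_sets_hausdorff by (simp add: L2 set_lebesgue_integral_def)
  with pos1 have A0: "A > 0" by simp

  define k where "k x = poly (jacobi_poly d t) (1 - x \<bullet> xt)" for x
  have k_cap: "\<nu> \<le> k y" if y: "y \<in> C" for y
  proof -
    have ny: "norm y = 1" and "cos (sqrt Y) \<le> y \<bullet> xt"
      using y by (auto simp: C_def cap_def inner_commute)
    define v where "v = 1 - y \<bullet> xt"
    have v0: "0 \<le> v"
      using Cauchy_Schwarz_ineq2[of y xt] ny nxt by (simp add: v_def)
    have vY: "v \<le> Y / 2"
      using one_minus_half_square_le_cos[of "sqrt Y"] \<open>cos _ \<le> _\<close> Y0 by (simp add: v_def)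
    have YL: "Y * (real t * (real t + real d) / (real d + 2)) = 1 - \<nu>"
      using t0 by (simp add: Y_def add_nonneg_eq_0_iff)
    have "real d + 1 \<le> real t * (real t + real d)"
      using t1 mult_mono[of 1 "real t" "1 + real d" "real t + real d"] by simp
    moreover have "(1 - \<nu>) * (real d + 2) \<le> real d + 2"
      using \<nu> by (simp add: algebra_simps)
    \<comment> \<open>\<open>Y \<le> 2\<close> puts \<open>v\<close> into \<open>[0, 1]\<close>, the
      range of the derivative bound.\<close>
    ultimately have "Y \<le> (real d + 2) / (real d + 1)"
      unfolding Y_def by (intro frac_le) auto
    also have "\<dots> \<le> 2"
      by (simp add: field_simps)
    finally have "v \<le> 1" using vY by simp
    \<comment> \<open>Because \<open>v\<close> is at most \<open>Y / 2\<close>, the kernel is even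
      at least \<open>(1 + \<nu>) / 2\<close> on the cap; the weaker bound \<open>\<nu>\<close>
      gives the stated constant.\<close>
    have "\<nu> \<le> 1 - (1 - \<nu>) / 2"
      using \<nu> by (simp add: field_simps)
    also have "(1 - \<nu>) / 2 = Y / 2 * (real t * (real t + real d) / (real d + 2))"
      by (simp only: YL[symmetric]) simp
    also have "1 - \<dots> \<le> 1 - v * (real t * (real t + real d) / (real d + 2))"
      using vY by (intro diff_left_mono mult_right_mono) auto
    also have "\<dots> \<le> k y"
      using jacobi_poly_ge[OF t1 v0 \<open>v \<le> 1\<close>] by (simp add: k_def v_def)
    finally show ?thesis .
  qed
  have norm_k: "sphere_L2sq k * real (dimPi d t) = 1"
  proof -
    have "sphere_L2sq k = sphere_int (\<lambda>x. poly (jacobi_poly d t * jacobi_poly d t) (1 - x \<bullet> xt))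
        / measure ?S usphere"
      by (simp add: L2 sphere_int_def k_def power2_eq_square)
    then show ?thesis
      using Z.L_jacobi_poly_square[of t] Z.L_jacobi_poly_dimPi[OF t1] by (simp only:)
  qed
  then have N0: "real (dimPi d t) > 0"
    by (cases "dimPi d t") auto
  have "continuous_on UNIV k"
    unfolding k_def by (intro continuous_intros)
  from lower[OF this _ k_cap] \<nu>
  have "\<nu>\<^sup>2 * (q * sqrt Y powr s) \<le> (\<integral>x\<in>X. \<bar>k x\<bar>\<^sup>2 * w x \<partial>H)"
    by simp
  also have "\<dots> = m * ((1 / m) * (\<integral>x\<in>X. \<bar>k x\<bar>\<^sup>2 * w x \<partial>H))"
    using m0 by simp
  also have "\<dots> \<le> m * (A * sphere_L2sq k)"
    using MZ poly_space_jacobi[of d t xt] m0 unfolding m_def k_def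
    by (intro mult_left_mono) auto
  also have "\<dots> = m * A / real (dimPi d t)"
    using norm_k N0 by (simp add: field_simps)
  finally have main: "q * \<nu>\<^sup>2 / A * sqrt Y powr s * real (dimPi d t) \<le> m"
    using N0 A0 by (simp add: field_simps)
  have "Y = ((1 - \<nu>) / (1 + d / t) * (d + 2)) / (real t)\<^sup>2"
  proof -
    have "1 + real d / real t = (real t + real d) / real t" and "real t + real d \<noteq> 0"
      using t0 by (auto simp: add_divide_distrib)
    then show ?thesis
      using t0 by (simp add: Y_def power2_eq_square divide_simps)
  qed
  moreover have "sqrt Y powr s = Y powr (s / 2)"
    using Y0 by (simp add: powr_half_sqrt[symmetric] powr_powr)
  ultimately have "sqrt Y powr s
      = ((1 - \<nu>) / (1 + d / t) * (d + 2)) powr (s / 2) / ((real t)\<^sup>2) powr (s / 2)"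
    using \<nu> by (simp only: powr_divide)
  also have "((real t)\<^sup>2) powr (s / 2) = real t powr s"
    using t0 by (simp add: powr_powr flip: powr_numeral)
  finally show ?thesis
    using main by (simp add: m_def)
qed

end
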